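(* Let $n\ge 1$ be an integer. (i) Let $1<p<2n+1$ and $\beta>0$ be such that $2n+2-\beta p>0$. Suppose there is a constant $C_{n,p,\beta}$, depending only on $n,p,\beta$, such that $$\|f^*_\delta\|_{L^p(S^{2n})}\le C_{n,p,\beta}\,\delta^{-\beta}\,\|f\|_{L^p(\mathbb{R}^{2n+1})}\qquad\text{for all } f\in L^p(\mathbb{R}^{2n+1}) \text{ and all } 0<\delta<1. \tag{$*$}$$ Then every bounded Besicovitch set $B\subset\mathbb{H}^n$ satisfies $\dim_H B\ge 2n+2-\beta p$, where $\dim_H$ is the Heisenberg Hausdorff dimension. (ii) In particular, if there is some $p$ with $1\le p<\infty$ such that for every $\beta>0$ the estimate $( * )$ holds (with some constant $C_{n,p,\beta}$), then every bounded Besicovitch set $B\subset\mathbb{H}^n$ has Heisenberg Hausdorff dimension $\dim_H B=2n+2$.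
   Context: The Heisenberg group $\mathbb{H}^n$ is $\mathbb{R}^{2n+1}$ with points written $(x,y,t)$, $x,y\in\mathbb{R}^n$, $t\in\mathbb{R}$, and group law $$(x,y,t)\ast(x',y',t')=(x+x',\,y+y',\,t+t'+2(\langle y,x'\rangle-\langle x,y'\rangle)),$$ where $\langle\cdot,\cdot\rangle$ is the usual inner product on $\mathbb{R}^n$; the inverse of $p=(x,y,t)$ is $p^{-1}=(-x,-y,-t)$. The Heisenberg (Korányi) metric is $d_H(p,q)=\|q^{-1}\ast p\|_H$ with $\|(x,y,t)\|_H=((\|x\|^2+\|y\|^2)^2+t^2)^{1/4}$, where $\|\cdot\|$ is the Euclidean norm. The Heisenberg Hausdorff dimension of $A\subset\mathbb{H}^n$ is $\dim_H A=\inf\{s\ge 0:\mathcal{H}^s_H(A)=0\}$, where $\mathcal{H}^s_H$ is the $s$-dimensional Hausdorff measure defined with respect to the metric $d_H$. A Besicovitch set (also called Kakeya set) in $\mathbb{H}^n$ is a Borel set $B\subset\mathbb{H}^n=\mathbb{R}^{2n+1}$ with Lebesgue measure $\mathcal{L}^{2n+1}(B)=0$ such that for every $e$ in the Euclidean unit sphere $S^{2n}\subset\mathbb{R}^{2n+1}$ there exists $b\in\mathbb{R}^{2n+1}$ with $\{te+b:t\in[0,1]\}\subset B$ (ordinary Euclidean line segments). For $0<\delta<1$, $e\in S^{2n}$, $a\in\mathbb{R}^{2n+1}$, let $$T^\delta_e(a)=\{q\in\mathbb{R}^{2n+1}:|\langle q-a,e\rangle|\le 1/2,\ |q-a-\langle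 q-a,e\rangle e|\le\delta\}$$ (Euclidean inner product and norm on $\mathbb{R}^{2n+1}$). The Kakeya maximal function of $f\in L^1_{loc}(\mathbb{R}^{2n+1})$ with width $\delta$ is $f^*_\delta:S^{2n}\to[0,\infty]$, $$f^*_\delta(e)=\sup_{a\in\mathbb{R}^{2n+1}}\frac{1}{\mathcal{L}^{2n+1}(T^\delta_e(a))}\int_{T^\delta_e(a)}|f|\,d\mathcal{L}^{2n+1}.$$ The space $L^p(S^{2n})$ is taken with respect to the surface measure $\sigma^{2n}$ on $S^{2n}$, and $L^p(\mathbb{R}^{2n+1})$ with respect to Lebesgue measure. *)

theory Defs
  imports "HOL-Analysis.Analysis"
begin

section \<open>The Heisenberg group\<close>

text \<open>
  The index type \<open>'n\<close> has \<open>n = CARD('n) \<ge> 1\<close> elements. The inner product, norm and Lebesgue measure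
  that the product type carries are the usual ones of \<open>\<real>\<^sup>2\<^sup>n\<^sup>+\<^sup>1\<close>.
\<close>

type_synonym 'n heis = "(real ^ 'n) \<times> (real ^ 'n) \<times> real"

fun heis_mult :: "'n::finite heis \<Rightarrow> 'n heis \<Rightarrow> 'n heis" where
  "heis_mult (x, y, t) (x', y', t') = (x + x', y + y', t + t' + 2 * (y \<bullet> x' - x \<bullet> y'))"

fun heis_inv :: "'n::finite heis \<Rightarrow> 'n heis" where
  "heis_inv (x, y, t) = (- x, - y, - t)"

fun heis_norm :: "'n::finite heis \<Rightarrow> real" where
  "heis_norm (x, y, t) = root 4 (((norm x)\<^sup>2 + (norm y)\<^sup>2)\<^sup>2 + t\<^sup>2)"

definition heis_dist :: "'n::finite heis \<Rightarrow> 'n heis \<Rightarrow> real" where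
  "heis_dist p q = heis_norm (heis_mult (heis_inv q) p)"

section \<open>Hausdorff measure and dimension with respect to a metric\<close>

text \<open>Only meaningful for exponents \<open>p > 0\<close>.\<close>

definition ennreal_powr :: "ennreal \<Rightarrow> real \<Rightarrow> ennreal" where
  "ennreal_powr x p = (if x = \<infinity> then \<infinity> else ennreal (enn2real x powr p))"

text \<open>
  The metric is an explicit argument because the metric of the type class on
  \<^typ>\<open>'n heis\<close> is the Euclidean one.
\<close>

definition diam_wrt :: "('a \<Rightarrow> 'a \<Rightarrow> real) \<Rightarrow> 'a set \<Rightarrow> ennreal" where
  "diam_wrt d U = (SUP x\<in>U. SUP y\<in>U. ennreal (d x y))"

text \<open>For \<open>s = 0\<close> every nonempty set contributes 1, so that \<open>\<H>\<^sup>0\<close> is the counting measure.\<close>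

definition diam_pow :: "('a \<Rightarrow> 'a \<Rightarrow> real) \<Rightarrow> real \<Rightarrow> 'a set \<Rightarrow> ennreal" where
  "diam_pow d s U =
     (if U = {} then 0 else if s = 0 then 1 else ennreal_powr (diam_wrt d U) s)"

definition hausdorff_premeasure ::
    "('a \<Rightarrow> 'a \<Rightarrow> real) \<Rightarrow> real \<Rightarrow> real \<Rightarrow> 'a set \<Rightarrow> ennreal" where
  "hausdorff_premeasure d s \<epsilon> A =
     (INF U\<in>{U :: nat \<Rightarrow> 'a set. A \<subseteq> (\<Union>i. U i) \<and> (\<forall>i. diam_wrt d (U i) \<le> ennreal \<epsilon>)}.
        \<Sum>i. diam_pow d s (U i))"

definition hausdorff_measure :: "('a \<Rightarrow> 'a \<Rightarrow> real) \<Rightarrow> real \<Rightarrow> 'a set \<Rightarrow> ennreal" where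
  "hausdorff_measure d s A = (SUP \<epsilon>\<in>{0<..}. hausdorff_premeasure d s \<epsilon> A)"

definition hausdorff_dim :: "('a \<Rightarrow> 'a \<Rightarrow> real) \<Rightarrow> 'a set \<Rightarrow> ereal" where
  "hausdorff_dim d A = Inf {ereal s |s. 0 \<le> s \<and> hausdorff_measure d s A = 0}"

definition heis_dim :: "'n::finite heis set \<Rightarrow> ereal" where
  "heis_dim A = hausdorff_dim heis_dist A"

section \<open>Besicovitch sets\<close>

definition besicovitch :: "'a::euclidean_space set \<Rightarrow> bool" where
  "besicovitch B \<longleftrightarrow>
     B \<in> sets borel \<and> emeasure lborel B = 0 \<and>
     (\<forall>e\<in>sphere 0 1. \<exists>b. (\<lambda>t. t *\<^sub>R e + b) ` {0..1} \<subseteq> B)"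

section \<open>The Kakeya maximal function\<close>

text \<open>
  Surface measure on the unit sphere, by polar coordinates:
  \<open>\<sigma> A = d \<cdot> \<L>\<^sup>d {r e | 0 < r \<le> 1, e \<in> A}\<close> for Borel \<open>A\<close>, where \<open>d\<close> is the dimension of
  the ambient space; see \<open>emeasure_sphere_measure\<close> below.
\<close>

definition sphere_measure :: "'a::euclidean_space measure" where
  "sphere_measure = scale_measure (of_nat DIM('a))
     (distr (restrict_space lborel (cball 0 1 - {0})) (restrict_space borel (sphere 0 1))
        (\<lambda>x. x /\<^sub>R norm x))"

lemma emeasure_sphere_measure:
  fixes A :: "'a::euclidean_space set"
  assumes "A \<in> sets borel" "A \<subseteq> sphere 0 1"
  shows "emeasure sphere_measure A =
    of_nat DIM('a) * emeasure lborel {r *\<^sub>R e |r e. 0 < r \<and> r \<le> 1 \<and> e \<in> A}"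
proof -
  let ?X = "restrict_space lborel (cball 0 1 - {0}) :: 'a measure"
  let ?Y = "restrict_space borel (sphere 0 1) :: 'a measure"
  let ?\<pi> = "\<lambda>x::'a. x /\<^sub>R norm x"
  have sp: "space ?X = cball 0 1 - {0}"
    by (simp add: space_restrict_space)
  have "?\<pi> \<in> borel_measurable ?X"
    by (intro measurable_restrict_space1) measurable
  then have meas: "?\<pi> \<in> measurable ?X ?Y"
    by (intro measurable_restrict_space2) (auto simp: sp)
  have A: "A \<in> sets ?Y"
    using assms by (auto simp: sets_restrict_space_iff)
  have eq: "?\<pi> -` A \<inter> space ?X = {r *\<^sub>R e |r e. 0 < r \<and> r \<le> 1 \<and> e \<in> A}"
    (is "?L = ?R")
  proof
    show "?L \<subseteq> ?R"
    proof
      fix x assume "x \<in> ?L"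
      then have "x \<noteq> 0" "norm x \<le> 1" "?\<pi> x \<in> A"
        by (auto simp: sp)
      then show "x \<in> ?R"
        by (intro CollectI exI[of _ "norm x"] exI[of _ "?\<pi> x"]) auto
    qed
    show "?R \<subseteq> ?L"
    proof
      fix x assume "x \<in> ?R"
      then obtain r e where re: "x = r *\<^sub>R e" "0 < r" "r \<le> 1" "e \<in> A"
        by blast
      have "norm e = 1"
        using re assms(2) by auto
      with re show "x \<in> ?L"
        by (auto simp: sp)
    qed
  qed
  have "emeasure ?X (?\<pi> -` A \<inter> space ?X) = emeasure lborel (?\<pi> -` A \<inter> space ?X)"
    by (rule emeasure_restrict_space) (auto simp: sp)
  then show ?thesis
    by (simp only: sphere_measure_def emeasure_scale_measure emeasure_distr[OF meas A] eq)
qed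

definition tube :: "real \<Rightarrow> 'a::euclidean_space \<Rightarrow> 'a \<Rightarrow> 'a set" where
  "tube \<delta> e a =
     {q. \<bar>(q - a) \<bullet> e\<bar> \<le> 1/2 \<and> norm (q - a - ((q - a) \<bullet> e) *\<^sub>R e) \<le> \<delta>}"

definition kakeya_maximal :: "real \<Rightarrow> ('a::euclidean_space \<Rightarrow> real) \<Rightarrow> 'a \<Rightarrow> ennreal" where
  "kakeya_maximal \<delta> f e =
     (SUP a. (\<integral>\<^sup>+q\<in>tube \<delta> e a. ennreal \<bar>f q\<bar> \<partial>lebesgue) / emeasure lebesgue (tube \<delta> e a))"

definition Lp_norm :: "'a measure \<Rightarrow> real \<Rightarrow> ('a \<Rightarrow> ennreal) \<Rightarrow> ennreal" where
  "Lp_norm M p g = ennreal_powr (\<integral>\<^sup>+x. ennreal_powr (g x) p \<partial>M) (1 / p)"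

definition kakeya_maximal_estimate :: "'a::euclidean_space itself \<Rightarrow> real \<Rightarrow> real \<Rightarrow> bool" where
  "kakeya_maximal_estimate _ p \<beta> \<longleftrightarrow>
     (\<exists>C::real. \<forall>f :: 'a \<Rightarrow> real. \<forall>\<delta>.
        f \<in> borel_measurable lebesgue \<and> Lp_norm lebesgue p (\<lambda>x. ennreal \<bar>f x\<bar>) < \<infinity> \<and>
        0 < \<delta> \<and> \<delta> < 1 \<longrightarrow>
        Lp_norm sphere_measure p (kakeya_maximal \<delta> f)
          \<le> ennreal (C * \<delta> powr (- \<beta>)) * Lp_norm lebesgue p (\<lambda>x. ennreal \<bar>f x\<bar>))"

end

theory Submission
  imports Defs
begin

text \<open>
  The upper bound for the dimension of a bounded set is volume counting: a Heisenberg ball of radius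
  \<open>r\<close> has volume comparable to \<open>r\<^sup>2\<^sup>n\<^sup>+\<^sup>2\<close> (\<open>hausdorff_measure_heis_eq_0\<close>).

  For the lower bound, take a cover of a bounded Besicovitch set \<open>B\<close> by Heisenberg balls of one radius
  \<open>\<delta>\<close>. Such a ball is comparable with a Euclidean plate: a disc of radius \<open>\<delta>\<close> in the horizontal plane through its centre,
  thickened by \<open>\<delta>\<^sup>2\<close>. Since \<open>B\<close> is bounded, a segment of \<open>B\<close> whose direction is close enough to the
  vertical axis crosses the horizontal planes along it at an angle bounded from below. Each plate then
  covers a length of only about \<open>\<delta>\<^sup>2\<close> of the segment, but the plates stacked along the segment
  fill a fixed proportion of the Euclidean tube of width \<open>\<delta>\<close>, and not of \<open>\<delta>\<^sup>2\<close>, about it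
  (\<open>emeasure_open_tube_Int_swept_set\<close>). The maximal function at width \<open>\<delta>\<close> of the indicator function of
  the union of the plates is therefore bounded below on a cap of directions of positive measure. If
  there are \<open>N\<close> plates, the maximal estimate gives \<open>1 \<lesssim> \<delta>\<^sup>-\<^sup>\<beta>\<^sup>p N \<delta>\<^sup>2\<^sup>n\<^sup>+\<^sup>2\<close>, that is, \<open>N\<close> is
  at least of the order of \<open>\<delta>\<close> to the power \<open>- (2 n + 2 - \<beta> p)\<close>.

  For Hausdorff instead of box dimension, a cover is sorted into dyadic levels
  (\<open>dyadic_cover_if_hausdorff_measure_0\<close>). On each segment some level \<open>k\<close> covers a length that decays
  geometrically in \<open>k\<close>, with a ratio as close to \<open>1\<close> as desired; the loss is absorbed by the gap between the
  exponent of the cover and the claimed dimension, and the measures of the sets of directions add up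
  to less than the measure of the cap (\<open>hausdorff_measure_ne_0_if_kakeya_maximal_estimate\<close>).

  When every \<open>\<beta> > 0\<close> is admissible, the two bounds meet as \<open>\<beta>\<close> tends to \<open>0\<close>.
\<close>

section \<open>Plates in the Heisenberg group\<close>

text \<open>
  The left translate by \<open>p\<close> of the box of horizontal size \<open>r\<close> and vertical size \<open>r\<^sup>2\<close>. It is
  comparable with the Heisenberg ball of radius \<open>r\<close> about \<open>p\<close>, but its volume follows at once
  from Fubini's theorem.
\<close>

definition heis_plate :: "'n::finite heis \<Rightarrow> real \<Rightarrow> 'n heis set" where
  "heis_plate p r =
     {q. case heis_mult (heis_inv p) q of (u, v, w) \<Rightarrow> norm u \<le> r \<and> norm v \<le> r \<and> \<bar>w\<bar> \<le> r\<^sup>2}"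

text \<open>
  In Euclidean terms a plate is a neighbourhood of thickness \<open>r\<^sup>2\<close> of a disc of radius \<open>r\<close> in the
  horizontal plane through its centre, and this plane tilts with the centre.
\<close>

lemma mem_heis_plate:
  "(x, y, t) \<in> heis_plate (a, b, c) r \<longleftrightarrow>
     norm (x - a) \<le> r \<and> norm (y - b) \<le> r \<and> \<bar>t - (c + 2 * (b \<bullet> x - a \<bullet> y))\<bar> \<le> r\<^sup>2"
proof -
  have "\<bar>t - c + 2 * (a \<bullet> y - b \<bullet> x)\<bar> = \<bar>t - (c + 2 * (b \<bullet> x - a \<bullet> y))\<bar>"
    by (rule arg_cong[where f = abs]) (simp add: algebra_simps)
  then show ?thesis
    by (simp add: heis_plate_def algebra_simps)
qed

lemma abs_symplectic_le:
  fixes x y u v :: "'a::real_inner"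
  assumes "norm x \<le> r" "norm y \<le> r" "norm u \<le> s" "norm v \<le> s"
  shows "\<bar>y \<bullet> u - x \<bullet> v\<bar> \<le> 2 * r * s"
proof -
  have "0 \<le> r"
    using assms(1) norm_ge_zero order_trans by blast
  then have "norm y * norm u \<le> r * s" "norm x * norm v \<le> r * s"
    using assms by (auto intro!: mult_mono)
  moreover have "\<bar>y \<bullet> u\<bar> \<le> norm y * norm u" "\<bar>x \<bullet> v\<bar> \<le> norm x * norm v"
    by (rule Cauchy_Schwarz_ineq2)+
  ultimately show ?thesis
    by linarith
qed

lemma heis_dist_le_imp_mem_plate:
  assumes "heis_dist q p \<le> r"
  shows "q \<in> heis_plate p r"
proof -
  obtain u v w where uvw: "heis_mult (heis_inv p) q = (u, v, w)"
    by (metis prod_cases3)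
  define S where "S = ((norm u)\<^sup>2 + (norm v)\<^sup>2)\<^sup>2 + w\<^sup>2"
  have S: "root 4 S \<le> r"
    using assms by (simp add: heis_dist_def uvw S_def)
  have S0: "0 \<le> S"
    by (simp add: S_def)
  have r: "0 \<le> r"
    using S S0 by (meson order_trans real_root_ge_zero)
  have "S = root 4 S ^ 4"
    using S0 by simp
  also have "\<dots> \<le> r ^ 4"
    using S S0 by (intro power_mono) auto
  finally have le: "S \<le> (r\<^sup>2)\<^sup>2"
    by simp
  have "((norm u)\<^sup>2 + (norm v)\<^sup>2)\<^sup>2 \<le> (r\<^sup>2)\<^sup>2" "w\<^sup>2 \<le> (r\<^sup>2)\<^sup>2"
    using le zero_le_power2[of w] zero_le_power2[of "(norm u)\<^sup>2 + (norm v)\<^sup>2"]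
    unfolding S_def by linarith+
  then have "(norm u)\<^sup>2 + (norm v)\<^sup>2 \<le> r\<^sup>2" "\<bar>w\<bar> \<le> r\<^sup>2"
    by (auto intro: power2_le_imp_le abs_le_square_iff[THEN iffD2, of w "r\<^sup>2", simplified])
  then have "(norm u)\<^sup>2 \<le> r\<^sup>2" "(norm v)\<^sup>2 \<le> r\<^sup>2"
    using zero_le_power2[of "norm u"] zero_le_power2[of "norm v"] by linarith+
  then have "norm u \<le> r" "norm v \<le> r"
    using r by (auto intro: power2_le_imp_le)
  with \<open>\<bar>w\<bar> \<le> r\<^sup>2\<close> show ?thesis
    by (simp add: heis_plate_def uvw)
qed

text \<open>
  Right multiplication by \<open>(u, v, 0)\<close> is a move inside the horizontal plane through \<open>g\<close>. Such a move
  is as cheap for the Heisenberg metric as for the Euclidean one, so that a whole horizontal disc of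
  radius \<open>r\<close> about a point of a plate stays in the enlarged plate.
\<close>

lemma heis_mult_horizontal_mem_plate:
  assumes "g \<in> heis_plate p r" "norm u \<le> r" "norm v \<le> r"
  shows "heis_mult g (u, v, 0) \<in> heis_plate p (3 * r)"
proof -
  obtain x y t where g: "g = (x, y, t)" by (metis prod_cases3)
  obtain a b c where p: "p = (a, b, c)" by (metis prod_cases3)
  have h: "norm (x - a) \<le> r" "norm (y - b) \<le> r" "\<bar>t - (c + 2 * (b \<bullet> x - a \<bullet> y))\<bar> \<le> r\<^sup>2"
    using assms(1) by (auto simp: g p mem_heis_plate)
  have r: "0 \<le> r"
    using assms(2) norm_ge_zero order_trans by blast
  have n: "norm (x + u - a) \<le> 3 * r" "norm (y + v - b) \<le> 3 * r"
    using h(1,2) assms(2,3) norm_triangle_ineq[of "x - a" u] norm_triangle_ineq[of "y - b" v] r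
    by (simp_all add: algebra_simps)
  have "\<bar>(y - b) \<bullet> u - (x - a) \<bullet> v\<bar> \<le> 2 * r * r"
    by (rule abs_symplectic_le) (use h assms in auto)
  moreover have "t + 2 * (y \<bullet> u - x \<bullet> v) - (c + 2 * (b \<bullet> (x + u) - a \<bullet> (y + v)))
      = (t - (c + 2 * (b \<bullet> x - a \<bullet> y))) + 2 * ((y - b) \<bullet> u - (x - a) \<bullet> v)"
    by (simp add: algebra_simps inner_simps)
  ultimately have "\<bar>t + 2 * (y \<bullet> u - x \<bullet> v) - (c + 2 * (b \<bullet> (x + u) - a \<bullet> (y + v)))\<bar> \<le> (3 * r)\<^sup>2"
    using h(3) zero_le_power2[of r] unfolding power_mult_distrib by (simp add: power2_eq_square)
  with n show ?thesis
    by (simp add: g p mem_heis_plate)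
qed

text \<open>
  This and the next lemma do the work of the triangle inequality. The factors come from the vertical
  coordinate of a product, in which the symplectic form adds at most \<open>4 r\<^sup>2\<close> to the two heights.
\<close>

lemma mem_plate_if_plates_meet:
  assumes "z \<in> heis_plate p r" "z \<in> heis_plate q r"
  shows "q \<in> heis_plate p (3 * r)"
proof -
  obtain x y t where z: "z = (x, y, t)" by (metis prod_cases3)
  obtain a b c where p: "p = (a, b, c)" by (metis prod_cases3)
  obtain a' b' c' where q: "q = (a', b', c')" by (metis prod_cases3)
  have h: "norm (x - a) \<le> r" "norm (y - b) \<le> r" "\<bar>t - (c + 2 * (b \<bullet> x - a \<bullet> y))\<bar> \<le> r\<^sup>2"
     "norm (x - a') \<le> r" "norm (y - b') \<le> r" "\<bar>t - (c' + 2 * (b' \<bullet> x - a' \<bullet> y))\<bar> \<le> r\<^sup>2"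
    using assms by (auto simp: z p q mem_heis_plate)
  have r: "0 \<le> r"
    using h(1) norm_ge_zero order_trans by blast
  have n: "norm (a' - a) \<le> 3 * r" "norm (b' - b) \<le> 3 * r"
    using h(1,2,4,5) norm_triangle_ineq4[of "x - a" "x - a'"] norm_triangle_ineq4[of "y - b" "y - b'"] r
    by (simp_all add: algebra_simps)
  have "\<bar>(y - b) \<bullet> (x - a') - (x - a) \<bullet> (y - b')\<bar> \<le> 2 * r * r"
    by (rule abs_symplectic_le) (use h in auto)
  moreover have "c' - (c + 2 * (b \<bullet> a' - a \<bullet> b'))
      = (t - (c + 2 * (b \<bullet> x - a \<bullet> y))) - (t - (c' + 2 * (b' \<bullet> x - a' \<bullet> y)))
         - 2 * ((y - b) \<bullet> (x - a') - (x - a) \<bullet> (y - b'))"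
    by (simp add: algebra_simps inner_simps inner_commute)
  ultimately have "\<bar>c' - (c + 2 * (b \<bullet> a' - a \<bullet> b'))\<bar> \<le> (3 * r)\<^sup>2"
    using h(3,6) zero_le_power2[of r] unfolding power_mult_distrib by (simp add: power2_eq_square)
  with n show ?thesis
    by (simp add: p q mem_heis_plate)
qed

lemma heis_dist_le_if_mem_plate:
  assumes "q \<in> heis_plate p r" "q' \<in> heis_plate p r"
  shows "heis_dist q q' \<le> 4 * r"
proof -
  obtain x y t where q: "q = (x, y, t)" by (metis prod_cases3)
  obtain a b c where p: "p = (a, b, c)" by (metis prod_cases3)
  obtain x' y' t' where q': "q' = (x', y', t')" by (metis prod_cases3)
  have h: "norm (x - a) \<le> r" "norm (y - b) \<le> r" "\<bar>t - (c + 2 * (b \<bullet> x - a \<bullet> y))\<bar> \<le> r\<^sup>2"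
     "norm (x' - a) \<le> r" "norm (y' - b) \<le> r" "\<bar>t' - (c + 2 * (b \<bullet> x' - a \<bullet> y'))\<bar> \<le> r\<^sup>2"
    using assms by (auto simp: q q' p mem_heis_plate)
  have r: "0 \<le> r"
    using h(1) norm_ge_zero order_trans by blast
  define w where "w = t - t' + 2 * (x' \<bullet> y - y' \<bullet> x)"
  have n: "norm (x - x') \<le> 2 * r" "norm (y - y') \<le> 2 * r"
    using h(1,2,4,5) norm_triangle_ineq4[of "x - a" "x' - a"] norm_triangle_ineq4[of "y - b" "y' - b"]
    by (simp_all add: algebra_simps)
  have "\<bar>(y' - b) \<bullet> (x - a) - (x' - a) \<bullet> (y - b)\<bar> \<le> 2 * r * r"
    by (rule abs_symplectic_le) (use h in auto)
  moreover have "w = (t - (c + 2 * (b \<bullet> x - a \<bullet> y))) - (t' - (c + 2 * (b \<bullet> x' - a \<bullet> y')))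
         - 2 * ((y' - b) \<bullet> (x - a) - (x' - a) \<bullet> (y - b))"
    by (simp add: w_def algebra_simps inner_simps inner_commute)
  ultimately have w: "\<bar>w\<bar> \<le> 6 * r\<^sup>2"
    using h(3,6) by (simp add: power2_eq_square)
  have "(norm (x - x'))\<^sup>2 \<le> (2 * r)\<^sup>2" "(norm (y - y'))\<^sup>2 \<le> (2 * r)\<^sup>2"
    using n by (intro power_mono; simp)+
  then have "((norm (x - x'))\<^sup>2 + (norm (y - y'))\<^sup>2)\<^sup>2 \<le> (8 * r\<^sup>2)\<^sup>2"
    by (intro power_mono) (auto simp: power_mult_distrib)
  moreover have "w\<^sup>2 \<le> (6 * r\<^sup>2)\<^sup>2"
    using w by (metis abs_le_square_iff abs_ge_zero abs_of_nonneg order_trans)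
  moreover have "(8 * r\<^sup>2)\<^sup>2 + (6 * r\<^sup>2)\<^sup>2 = 100 * r ^ 4" "(4 * r) ^ 4 = 256 * r ^ 4" "0 \<le> r ^ 4"
    by (simp_all add: power_mult_distrib)
  ultimately have "((norm (x - x'))\<^sup>2 + (norm (y - y'))\<^sup>2)\<^sup>2 + w\<^sup>2 \<le> (4 * r) ^ 4"
    by linarith
  then have "root 4 (((norm (x - x'))\<^sup>2 + (norm (y - y'))\<^sup>2)\<^sup>2 + w\<^sup>2) \<le> root 4 ((4 * r) ^ 4)"
    by simp
  also have "\<dots> = 4 * r"
    using r by (intro real_root_power_cancel) auto
  finally show ?thesis
    by (simp add: q q' heis_dist_def w_def algebra_simps)
qed

section \<open>Volumes by slicing\<close>

lemma nn_integral_heis_vertical: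
  fixes F :: "'n::finite heis \<Rightarrow> ennreal"
  assumes [measurable]: "F \<in> borel_measurable borel"
  shows "(\<integral>\<^sup>+q. F q \<partial>lborel) = (\<integral>\<^sup>+x. \<integral>\<^sup>+y. \<integral>\<^sup>+t. F (x, y, t) \<partial>lborel \<partial>lborel \<partial>lborel)"
proof -
  have "(\<integral>\<^sup>+q. F q \<partial>lborel) = (\<integral>\<^sup>+q. F q \<partial>(lborel \<Otimes>\<^sub>M lborel))"
    by (simp add: lborel_prod)
  also have "\<dots> = (\<integral>\<^sup>+x. \<integral>\<^sup>+z. F (x, z) \<partial>lborel \<partial>lborel)"
    by (rule lborel.nn_integral_fst[symmetric]) (simp add: lborel_prod)
  also have "\<dots> = (\<integral>\<^sup>+x. \<integral>\<^sup>+z. F (x, z) \<partial>(lborel \<Otimes>\<^sub>M lborel) \<partial>lborel)"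
    by (simp add: lborel_prod)
  also have "\<dots> = (\<integral>\<^sup>+x. \<integral>\<^sup>+y. \<integral>\<^sup>+t. F (x, y, t) \<partial>lborel \<partial>lborel \<partial>lborel)"
    by (intro nn_integral_cong, subst lborel.nn_integral_fst[symmetric]) (simp_all add: lborel_prod)
  finally show ?thesis .
qed

text \<open>
  A shear along the vertical axis translates each horizontal slice, so that it preserves volume. With
  \<open>\<phi>\<close> and \<open>\<psi>\<close> affine, this straightens lines that are transversal to the slices.
\<close>

lemma nn_integral_heis_sheared:
  fixes F :: "'n::finite heis \<Rightarrow> ennreal"
  assumes [measurable]: "F \<in> borel_measurable borel"
    "\<phi> \<in> borel_measurable borel" "\<psi> \<in> borel_measurable borel"
  shows "(\<integral>\<^sup>+q. F q \<partial>lborel) =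
    (\<integral>\<^sup>+x. \<integral>\<^sup>+y. \<integral>\<^sup>+t. F (x + \<phi> t, y + \<psi> t, t) \<partial>lborel \<partial>lborel \<partial>lborel)"
proof -
  have shift: "(\<integral>\<^sup>+z. H (z + c) \<partial>lborel) = (\<integral>\<^sup>+z. H z \<partial>lborel)"
    if [measurable]: "H \<in> borel_measurable borel" for H :: "real^'n \<Rightarrow> ennreal" and c
  proof -
    have "(\<integral>\<^sup>+z. H z \<partial>lborel) = (\<integral>\<^sup>+z. H z \<partial>distr lborel borel ((+) c))"
      by (simp add: lborel_distr_plus)
    also have "\<dots> = (\<integral>\<^sup>+z. H (z + c) \<partial>lborel)"
      by (subst nn_integral_distr) (simp_all add: add.commute)
    finally show ?thesis ..
  qed
  \<comment> \<open>Bring the vertical integral outside; there the shear is a translation in each horizontal variable.\<close>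
  have swap: "(\<integral>\<^sup>+x. \<integral>\<^sup>+y. \<integral>\<^sup>+t. H x y t \<partial>lborel \<partial>lborel \<partial>lborel) =
      (\<integral>\<^sup>+t. \<integral>\<^sup>+x. \<integral>\<^sup>+y. H x y t \<partial>lborel \<partial>lborel \<partial>lborel)"
    if [measurable]: "case_prod (\<lambda>x. case_prod (H x)) \<in> borel_measurable borel"
    for H :: "real^'n \<Rightarrow> real^'n \<Rightarrow> real \<Rightarrow> ennreal"
  proof -
    have [measurable]: "(\<lambda>q. H (f q) (g q) (h q)) \<in> borel_measurable M"
      if [measurable]: "f \<in> borel_measurable M" "g \<in> borel_measurable M" "h \<in> borel_measurable M"
      for f g h and M :: "'b measure"
    proof -
      have "(\<lambda>q. (case_prod (\<lambda>x. case_prod (H x))) (f q, g q, h q)) \<in> borel_measurable M"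
        by measurable
      then show ?thesis by simp
    qed
    have "(\<integral>\<^sup>+x. \<integral>\<^sup>+y. \<integral>\<^sup>+t. H x y t \<partial>lborel \<partial>lborel \<partial>lborel)
        = (\<integral>\<^sup>+x. \<integral>\<^sup>+t. \<integral>\<^sup>+y. H x y t \<partial>lborel \<partial>lborel \<partial>lborel)"
      by (intro nn_integral_cong lborel_pair.Fubini') simp
    also have "\<dots> = (\<integral>\<^sup>+t. \<integral>\<^sup>+x. \<integral>\<^sup>+y. H x y t \<partial>lborel \<partial>lborel \<partial>lborel)"
      by (intro lborel_pair.Fubini') simp
    finally show ?thesis .
  qed
  have [measurable]: "(\<lambda>q. F (f q, g q, h q)) \<in> borel_measurable M"
    if [measurable]: "f \<in> borel_measurable M" "g \<in> borel_measurable M" "h \<in> borel_measurable M"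
    for f g h and M :: "'b measure"
    by measurable
  have "(\<integral>\<^sup>+x. \<integral>\<^sup>+y. \<integral>\<^sup>+t. F (x + \<phi> t, y + \<psi> t, t) \<partial>lborel \<partial>lborel \<partial>lborel)
      = (\<integral>\<^sup>+t. \<integral>\<^sup>+x. \<integral>\<^sup>+y. F (x + \<phi> t, y + \<psi> t, t) \<partial>lborel \<partial>lborel \<partial>lborel)"
    by (rule swap) (simp add: case_prod_beta' borel_prod[symmetric])
  also have "\<dots> = (\<integral>\<^sup>+t. \<integral>\<^sup>+x. \<integral>\<^sup>+y. F (x + \<phi> t, y, t) \<partial>lborel \<partial>lborel \<partial>lborel)"
    by (rule nn_integral_cong, rule nn_integral_cong)
      (rule shift[where H = "\<lambda>y. F (x + \<phi> t, y, t)" and c = "\<psi> t" for x t], simp)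
  also have "\<dots> = (\<integral>\<^sup>+t. \<integral>\<^sup>+x. \<integral>\<^sup>+y. F (x, y, t) \<partial>lborel \<partial>lborel \<partial>lborel)"
    by (rule nn_integral_cong)
      (rule shift[where H = "\<lambda>x. \<integral>\<^sup>+y. F (x, y, t) \<partial>lborel" and c = "\<phi> t" for t], simp)
  also have "\<dots> = (\<integral>\<^sup>+x. \<integral>\<^sup>+y. \<integral>\<^sup>+t. F (x, y, t) \<partial>lborel \<partial>lborel \<partial>lborel)"
    by (rule swap[symmetric]) (simp add: case_prod_beta')
  also have "\<dots> = (\<integral>\<^sup>+q. F q \<partial>lborel)"
    by (rule nn_integral_heis_vertical[symmetric]) simp
  finally show ?thesis ..
qed

lemma heis_plate_measurable [measurable]: "heis_plate (p :: 'n::finite heis) r \<in> sets borel"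
proof -
  obtain a b c where p: "p = (a, b, c)" by (metis prod_cases3)
  have "heis_plate p r = {q. norm (fst q - a) \<le> r \<and> norm (fst (snd q) - b) \<le> r \<and>
      \<bar>snd (snd q) - (c + 2 * (b \<bullet> fst q - a \<bullet> fst (snd q)))\<bar> \<le> r\<^sup>2}"
    by (auto simp: p mem_heis_plate)
  also have "closed \<dots>"
    by (intro closed_Collect_conj closed_Collect_le continuous_intros)
  finally show ?thesis
    by (rule borel_closed)
qed

lemma emeasure_cball_cart:
  fixes a :: "real^'n"
  assumes "0 \<le> r"
  shows "emeasure lborel (cball a r) = ennreal (unit_ball_vol CARD('n) * r ^ CARD('n))"
  using emeasure_cball[OF assms, of a] by simp

lemma nn_integral_indicator_box:
  fixes A :: "'a::euclidean_space set" and B :: "'b::euclidean_space set"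
  assumes [measurable]: "A \<in> sets borel" "B \<in> sets borel"
  shows "(\<integral>\<^sup>+x. \<integral>\<^sup>+y. indicator A x * (indicator B y * \<kappa>) \<partial>lborel \<partial>lborel) =
    emeasure lborel A * (emeasure lborel B * \<kappa>)"
proof -
  have "(\<integral>\<^sup>+x. \<integral>\<^sup>+y. indicator A x * (indicator B y * \<kappa>) \<partial>lborel \<partial>lborel) =
     (\<integral>\<^sup>+x. indicator A x * (emeasure lborel B * \<kappa>) \<partial>lborel)"
    by (subst nn_integral_cmult, simp, subst nn_integral_multc, simp, simp)
  also have "\<dots> = emeasure lborel A * (emeasure lborel B * \<kappa>)"
    by (subst nn_integral_multc, simp, simp)
  finally show ?thesis .
qed

lemma emeasure_heis_plate:
  fixes p :: "'n::finite heis"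
  assumes "0 \<le> r"
  shows "emeasure lborel (heis_plate p r) =
    ennreal (2 * (unit_ball_vol CARD('n))\<^sup>2 * r ^ (2 * CARD('n) + 2))"
proof -
  obtain a b c where p: "p = (a, b, c)" by (metis prod_cases3)
  let ?\<tau> = "\<lambda>x y. c + 2 * (b \<bullet> x - a \<bullet> y)"
  have "emeasure lborel (heis_plate p r) = (\<integral>\<^sup>+q. indicator (heis_plate p r) q \<partial>lborel)"
    by simp
  also have "\<dots> = (\<integral>\<^sup>+x. \<integral>\<^sup>+y. \<integral>\<^sup>+t. indicator (heis_plate p r) (x, y, t) \<partial>lborel \<partial>lborel \<partial>lborel)"
    by (rule nn_integral_heis_vertical) simp
  also have "\<dots> = (\<integral>\<^sup>+x. \<integral>\<^sup>+y. \<integral>\<^sup>+t. indicator (cball a r) x * (indicator (cball b r) y *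
      indicator {?\<tau> x y - r\<^sup>2..?\<tau> x y + r\<^sup>2} t) \<partial>lborel \<partial>lborel \<partial>lborel)"
    by (intro nn_integral_cong)
      (auto simp: p mem_heis_plate indicator_def dist_norm norm_minus_commute abs_le_iff)
  also have "\<dots> = (\<integral>\<^sup>+x. \<integral>\<^sup>+y. indicator (cball a r) x * (indicator (cball b r) y * ennreal (2 * r\<^sup>2))
      \<partial>lborel \<partial>lborel)"
    by (intro nn_integral_cong) (simp add: nn_integral_cmult)
  also have "\<dots> = emeasure lborel (cball a r) * (emeasure lborel (cball b r) * ennreal (2 * r\<^sup>2))"
    by (rule nn_integral_indicator_box) simp_all
  also have "\<dots> = ennreal (2 * (unit_ball_vol CARD('n))\<^sup>2 * r ^ (2 * CARD('n) + 2))"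
    using assms unfolding emeasure_cball_cart[OF assms]
    by (subst ennreal_mult[symmetric], simp, simp)+
      (simp add: power_add power_mult power2_eq_square mult_ac power_mult_distrib)
  finally show ?thesis .
qed

lemma tube_measurable [measurable]: "tube \<delta> e a \<in> sets borel"
  unfolding tube_def
  by (intro borel_closed closed_Collect_conj closed_Collect_le continuous_intros)

lemma norm_le_triple: "norm x \<le> norm (x, y, t)" "norm y \<le> norm (x, y, t)" "\<bar>t\<bar> \<le> norm (x, y, t::real)"
  by (metis norm_fst_le norm_snd_le order_trans real_norm_def)+

lemma norm_triple_le: "norm (x, y, t::real) \<le> norm x + norm y + \<bar>t\<bar>"
  using norm_Pair_le[of x "(y, t)"] norm_Pair_le[of y t] by simp

section \<open>Tubes\<close>

text \<open>
  The order of magnitude is that of a tube in any direction. For steep directions it can be read off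
  from slices of constant height, which have radius at most \<open>2 \<delta>\<close>.
\<close>

lemma emeasure_steep_tube_le:
  fixes c d :: "real^'n" and a :: "'n heis"
  assumes e: "norm (c, d, h) = 1" and "0 < h" "norm c \<le> h" "norm d \<le> h" and \<delta>: "0 < \<delta>" "\<delta> < 1"
  shows "emeasure lborel (tube \<delta> (c, d, h) a) \<le>
    ennreal (3 * (unit_ball_vol CARD('n) * (2 * \<delta>) ^ CARD('n))\<^sup>2)"
proof -
  obtain a1 a2 a3 where a: "a = (a1, a2, a3)" by (metis prod_cases3)
  let ?T = "tube \<delta> (c, d, h) a"
  let ?u = "\<lambda>t. (t - a3) / h"
  have h1: "h \<le> 1"
    using norm_le_triple(3)[of h c d] e by simp
  \<comment> \<open>The tube lies in a cylinder over a product of two balls of radius \<open>2 \<delta>\<close>, sheared along its axis.\<close>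
  have bound: "norm (x - a1) \<le> 2 * \<delta> \<and> norm (y - a2) \<le> 2 * \<delta> \<and> \<bar>t - a3\<bar> \<le> 3/2"
    if q: "(x + ?u t *\<^sub>R c, y + ?u t *\<^sub>R d, t) \<in> ?T" for x y t
  proof -
    define q where "q = (x + ?u t *\<^sub>R c, y + ?u t *\<^sub>R d, t)"
    define s where "s = (q - a) \<bullet> (c, d, h)"
    define v1 v2 v3 where "v1 = x + ?u t *\<^sub>R c - a1 - s *\<^sub>R c" and "v2 = y + ?u t *\<^sub>R d - a2 - s *\<^sub>R d"
      and "v3 = t - a3 - s * h"
    have s: "\<bar>s\<bar> \<le> 1/2"
      using q by (simp add: tube_def s_def q_def)
    have "q - a - s *\<^sub>R (c, d, h) = (v1, v2, v3)"
      by (simp add: q_def a v1_def v2_def v3_def)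
    then have "norm (v1, v2, v3) \<le> \<delta>"
      using q by (simp add: tube_def s_def q_def)
    then have v: "norm v1 \<le> \<delta>" "norm v2 \<le> \<delta>" "\<bar>v3\<bar> \<le> \<delta>"
      using norm_le_triple[where x = v1 and y = v2 and t = v3] by linarith+
    have u: "?u t = s + v3 / h"
      using \<open>0 < h\<close> by (simp add: v3_def field_simps)
    have x: "x - a1 = v1 - (v3 / h) *\<^sub>R c" "y - a2 = v2 - (v3 / h) *\<^sub>R d"
      unfolding v1_def v2_def u by (simp_all add: algebra_simps)
    have "\<bar>v3\<bar> * norm c \<le> \<delta> * h" "\<bar>v3\<bar> * norm d \<le> \<delta> * h"
      using v(3) assms by (auto intro!: mult_mono)
    then have "norm ((v3 / h) *\<^sub>R c) \<le> \<delta>" "norm ((v3 / h) *\<^sub>R d) \<le> \<delta>"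
      using \<open>0 < h\<close> by (simp_all add: field_simps)
    then have "norm (x - a1) \<le> 2 * \<delta>" "norm (y - a2) \<le> 2 * \<delta>"
      unfolding x using v(1,2) norm_triangle_ineq4[of v1 "(v3 / h) *\<^sub>R c"]
        norm_triangle_ineq4[of v2 "(v3 / h) *\<^sub>R d"] by linarith+
    moreover have "\<bar>s * h\<bar> \<le> 1/2"
      using s h1 \<open>0 < h\<close> mult_mono[of "\<bar>s\<bar>" "1/2" h 1] by (simp add: abs_mult)
    then have "\<bar>t - a3\<bar> \<le> 3/2"
      using v(3) \<delta> unfolding v3_def by linarith
    ultimately show ?thesis by blast
  qed
  have "emeasure lborel ?T = (\<integral>\<^sup>+q. indicator ?T q \<partial>lborel)"
    by simp
  also have "\<dots> = (\<integral>\<^sup>+x. \<integral>\<^sup>+y. \<integral>\<^sup>+t. indicator ?T (x + ?u t *\<^sub>R c, y + ?u t *\<^sub>R d, t)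
      \<partial>lborel \<partial>lborel \<partial>lborel)"
    by (rule nn_integral_heis_sheared) simp_all
  also have "\<dots> \<le> (\<integral>\<^sup>+x. \<integral>\<^sup>+y. \<integral>\<^sup>+t. indicator (cball a1 (2 * \<delta>)) x * (indicator (cball a2 (2 * \<delta>)) y *
      indicator {a3 - 3/2..a3 + 3/2} t) \<partial>lborel \<partial>lborel \<partial>lborel)"
    by (intro nn_integral_mono)
      (use bound in \<open>fastforce simp: indicator_def dist_norm norm_minus_commute abs_le_iff\<close>)
  also have "\<dots> = (\<integral>\<^sup>+x. \<integral>\<^sup>+y. indicator (cball a1 (2 * \<delta>)) x * (indicator (cball a2 (2 * \<delta>)) y * ennreal 3)
      \<partial>lborel \<partial>lborel)"
    by (intro nn_integral_cong) (simp add: nn_integral_cmult)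
  also have "\<dots> = emeasure lborel (cball a1 (2 * \<delta>)) * (emeasure lborel (cball a2 (2 * \<delta>)) * ennreal 3)"
    by (rule nn_integral_indicator_box) simp_all
  also have "\<dots> = ennreal (3 * (unit_ball_vol CARD('n) * (2 * \<delta>) ^ CARD('n))\<^sup>2)"
    using \<delta>
    by (simp add: emeasure_cball_cart ennreal_mult[symmetric] power2_eq_square mult_ac
        del: ennreal_numeral)
  finally show ?thesis .
qed

text \<open>
  With strict inequalities, membership of a fixed point is an open condition on the direction. The
  measure of the intersection with a fixed set is therefore lower semicontinuous in the direction, and
  so is its supremum over all centres. Closed tubes give upper semicontinuity, which a supremum does
  not preserve.
\<close>

definition open_tube :: "real \<Rightarrow> 'a::euclidean_space \<Rightarrow> 'a \<Rightarrow> 'a set" where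
  "open_tube \<delta> e a =
     {q. \<bar>(q - a) \<bullet> e\<bar> < 1/2 \<and> norm (q - a - ((q - a) \<bullet> e) *\<^sub>R e) < \<delta>}"

lemma open_open_tube: "open (open_tube \<delta> e a)"
  unfolding open_tube_def
  by (intro open_Collect_conj open_Collect_less continuous_intros)

lemma open_tube_measurable [measurable]: "open_tube \<delta> e a \<in> sets borel"
  by (rule borel_open[OF open_open_tube])

lemma open_tube_subset_tube: "open_tube \<delta> e a \<subseteq> tube \<delta> e a"
  by (auto simp: open_tube_def tube_def)

text \<open>
  Fatou's lemma, applied to the indicator functions of the tubes.
\<close>

lemma open_directions_large_open_tube:
  fixes G :: "'a::euclidean_space set"
  assumes [measurable]: "G \<in> sets borel"
  shows "open {e. \<kappa> < emeasure lborel (open_tube \<delta> e a \<inter> G)}"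
proof -
  have "closed {e. emeasure lborel (open_tube \<delta> e a \<inter> G) \<le> \<kappa>}"
    unfolding closed_sequential_limits
  proof (intro allI impI, elim conjE)
    fix e :: "nat \<Rightarrow> 'a" and l
    assume le: "\<forall>n. e n \<in> {e. emeasure lborel (open_tube \<delta> e a \<inter> G) \<le> \<kappa>}" and lim: "e \<longlonglongrightarrow> l"
    have ind: "indicator (open_tube \<delta> l a \<inter> G) q \<le>
        liminf (\<lambda>n. indicator (open_tube \<delta> (e n) a \<inter> G) q :: ennreal)" for q
    proof (cases "q \<in> open_tube \<delta> l a \<inter> G")
      case True
      have "(\<lambda>n. \<bar>(q - a) \<bullet> e n\<bar>) \<longlonglongrightarrow> \<bar>(q - a) \<bullet> l\<bar>"
        "(\<lambda>n. norm (q - a - ((q - a) \<bullet> e n) *\<^sub>R e n)) \<longlonglongrightarrow> norm (q - a - ((q - a) \<bullet> l) *\<^sub>R l)"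
        by (intro tendsto_intros lim)+
      moreover have "\<bar>(q - a) \<bullet> l\<bar> < 1/2" "norm (q - a - ((q - a) \<bullet> l) *\<^sub>R l) < \<delta>"
        using True unfolding open_tube_def by blast+
      ultimately have "\<forall>\<^sub>F n in sequentially. \<bar>(q - a) \<bullet> e n\<bar> < 1/2 \<and>
          norm (q - a - ((q - a) \<bullet> e n) *\<^sub>R e n) < \<delta>"
        by (intro eventually_conj order_tendstoD(2))
      then have "\<forall>\<^sub>F n in sequentially. indicator (open_tube \<delta> (e n) a \<inter> G) q = (1 :: ennreal)"
        by eventually_elim (use True in \<open>auto simp: open_tube_def\<close>)
      then have "(\<lambda>n. indicator (open_tube \<delta> (e n) a \<inter> G) q :: ennreal) \<longlonglongrightarrow> 1"
        by (rule tendsto_eventually)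
      then show ?thesis
        using lim_imp_Liminf[of sequentially] True by fastforce
    qed simp
    have "emeasure lborel (open_tube \<delta> l a \<inter> G) = (\<integral>\<^sup>+q. indicator (open_tube \<delta> l a \<inter> G) q \<partial>lborel)"
      by simp
    also have "\<dots> \<le> (\<integral>\<^sup>+q. liminf (\<lambda>n. indicator (open_tube \<delta> (e n) a \<inter> G) q) \<partial>lborel)"
      by (intro nn_integral_mono ind)
    also have "\<dots> \<le> liminf (\<lambda>n. \<integral>\<^sup>+q. indicator (open_tube \<delta> (e n) a \<inter> G) q \<partial>lborel)"
      by (intro nn_integral_liminf) simp
    also have "\<dots> \<le> liminf (\<lambda>n. \<kappa>)"
      using le by (intro Liminf_mono) simp
    also have "\<dots> = \<kappa>"
      by (intro Liminf_const) simp
    finally show "l \<in> {e. emeasure lborel (open_tube \<delta> e a \<inter> G) \<le> \<kappa>}"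
      by simp
  qed
  then show ?thesis
    by (simp add: closed_def Collect_neg_eq[symmetric] not_le)
qed

section \<open>Sweeping a segment along horizontal planes\<close>

text \<open>
  This is where the Heisenberg geometry improves on a Euclidean count. Let \<open>b\<close> and \<open>e = (c, d, h)\<close> be
  the base point and the direction of a segment, and \<open>\<omega>(z, w) = y \<bullet> u - x \<bullet> v\<close> for \<open>z = (x, y)\<close>,
  \<open>w = (u, v)\<close>. The horizontal plane at \<open>t e + b\<close> contains the vectors \<open>(w, 2 \<omega>(b + t e, w))\<close>, so
  that \<open>e\<close> misses it by the height \<open>h - 2 \<omega>(b, e) = h \<kappa>\<close>, which is the same for all \<open>t\<close> because
  \<open>\<omega>(e, e) = 0\<close>. The direction is so steep, in terms of the bound \<open>R\<close> on \<open>b\<close>, that \<open>\<kappa> \<ge> 1/2\<close>. Hence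
  the horizontal discs of radius about \<open>\<delta>\<close> centred at the points with parameter in \<open>J\<close> are stacked
  transversally to the segment, and together they fill a volume comparable to \<open>\<delta>\<^sup>2\<^sup>n \<bar>J\<bar>\<close>, although
  each of them is null.

  For the proof, fix the horizontal displacement \<open>\<zeta> = (x, y)\<close> from the line, measured at constant
  height. The disc at parameter \<open>t\<close> meets the translate of the line by \<open>\<zeta>\<close> at the displacement
  \<open>w = \<zeta> + (2 \<mu> / h) e\<close> with \<open>\<mu> = \<omega>(b + t e, w)\<close>. This linear equation for \<open>\<mu>\<close> has the solution
  \<open>\<mu> = (\<omega>(b, \<zeta>) + t \<omega>(e, \<zeta>)) / \<kappa>\<close>. The height \<open>A t\<close> of the intersection point is thus an affine
  function of \<open>t\<close> with slope close to \<open>h\<close>, so that the heights reached from \<open>J\<close> have measure at least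
  \<open>\<bar>J\<bar> / 4\<close>. Fubini's theorem in the sheared coordinates sums this over \<open>\<zeta>\<close>.

  The parameters keep a distance \<open>1/4\<close> from the ends of the segment, which leaves room for the swept
  points inside the tube.
\<close>

lemma emeasure_open_tube_Int_swept_set:
  fixes c d b1 b2 :: "real^'n" and G :: "'n heis set"
  assumes e: "norm (c, d, h) = 1" and h: "0 < h" and R: "1 \<le> R"
    and cd: "norm c \<le> h / (8 * R)" "norm d \<le> h / (8 * R)"
    and b: "norm b1 \<le> R" "norm b2 \<le> R"
    and \<delta>: "0 < \<delta>" "\<delta> < 1"
    and J: "J \<in> sets borel" "J \<subseteq> {1/4..3/4}" and G [measurable]: "G \<in> sets borel"
    and sweep: "\<And>t u v. t \<in> J \<Longrightarrow> norm u \<le> \<delta> \<Longrightarrow> norm v \<le> \<delta> \<Longrightarrow>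
      heis_mult (t *\<^sub>R (c, d, h) + (b1, b2, b3)) (u, v, 0) \<in> G"
  shows "ennreal ((unit_ball_vol CARD('n) * (\<delta> / (80 * R)) ^ CARD('n))\<^sup>2 / 4) * emeasure lborel J
    \<le> emeasure lborel (open_tube \<delta> (c, d, h) ((1/2) *\<^sub>R (c, d, h) + (b1, b2, b3)) \<inter> G)"
proof -
  define a where "a = (1/2) *\<^sub>R (c, d, h) + (b1, b2, b3)"
  define X where "X = open_tube \<delta> (c, d, h) a \<inter> G"
  \<comment> \<open>For displacements \<open>\<zeta>\<close> up to this size the swept points stay within \<open>\<delta> / 4\<close> of the
    segment, hence inside the tube, and the slope of \<open>A\<close> below is at least \<open>1/4\<close>.\<close>
  define \<rho> where "\<rho> = \<delta> / (80 * R)"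
  define \<omega> where "\<omega> = b2 \<bullet> c - b1 \<bullet> d"
  define \<kappa> where "\<kappa> = 1 - 2 * \<omega> / h"
  define \<phi> \<psi> where "\<phi> = (\<lambda>t. b1 + ((t - b3) / h) *\<^sub>R c)" and "\<psi> = (\<lambda>t. b2 + ((t - b3) / h) *\<^sub>R d)"
  have X [measurable]: "X \<in> sets borel"
    by (simp add: X_def)
  have \<rho>: "0 < \<rho>" "R * \<rho> = \<delta> / 80" "\<rho> \<le> \<delta> / 80"
    using R \<delta> by (auto simp: \<rho>_def field_simps)
  have h1: "h \<le> 1"
    using norm_le_triple(3)[of h c d] e by simp
  have "\<bar>\<omega>\<bar> \<le> 2 * R * (h / (8 * R))"
    unfolding \<omega>_def by (rule abs_symplectic_le) (use cd b in auto)
  also have "\<dots> = h / 4"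
    using R by simp
  finally have "\<bar>2 * \<omega> / h\<bar> \<le> 1/2"
    using h by (simp add: abs_mult divide_le_eq)
  then have \<kappa>: "1/2 \<le> \<kappa>"
    unfolding \<kappa>_def by linarith
  have small: "norm c \<le> 1/8" "norm d \<le> 1/8"
  proof -
    have "h / (8 * R) \<le> 1 / 8"
      using h1 h R frac_le[of 1 h 8 "8 * R"] by simp
    then show "norm c \<le> 1/8" "norm d \<le> 1/8"
      using cd by linarith+
  qed
  have slice: "ennreal (1/4) * emeasure lborel J
      \<le> (\<integral>\<^sup>+t. indicator X (x + \<phi> t, y + \<psi> t, t) \<partial>lborel)"
    if x: "norm x \<le> \<rho>" and y: "norm y \<le> \<rho>" for x y
  proof -
    define \<alpha> \<gamma> where "\<alpha> = b2 \<bullet> x - b1 \<bullet> y" and "\<gamma> = d \<bullet> x - c \<bullet> y"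
    define \<mu> where "\<mu> = (\<lambda>t. (\<alpha> + t * \<gamma>) / \<kappa>)"
    \<comment> \<open>The height at which the horizontal plane through the point with parameter \<open>t\<close> meets the
      translate by \<open>(x, y)\<close> of the line; it depends affinely on \<open>t\<close>.\<close>
    define A where "A = (\<lambda>t. b3 + t * h + 2 * \<mu> t)"
    have "\<bar>\<alpha>\<bar> \<le> 2 * R * \<rho>"
      unfolding \<alpha>_def by (rule abs_symplectic_le) (use x y b in auto)
    then have \<alpha>: "\<bar>\<alpha>\<bar> \<le> \<delta> / 40"
      using \<rho> by linarith
    have "\<bar>\<gamma>\<bar> \<le> 2 * (1/8) * \<rho>"
      unfolding \<gamma>_def by (rule abs_symplectic_le) (use x y small in auto)
    then have \<gamma>: "\<bar>\<gamma>\<bar> \<le> \<rho> / 4"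
      by simp
    have inX: "(x + \<phi> (A t), y + \<psi> (A t), A t) \<in> X" if t: "t \<in> J" for t
    proof -
      define l where "l = \<mu> t"
      define u v where "u = x + (2 * l / h) *\<^sub>R c" and "v = y + (2 * l / h) *\<^sub>R d"
      have "1/4 \<le> t \<and> t \<le> 3/4"
        using t J(2) by auto
      then have t01: "\<bar>t\<bar> \<le> 1" "\<bar>t - 1/2\<bar> \<le> 1/4"
        by linarith+
      have "\<bar>t * \<gamma>\<bar> \<le> 1 * (\<rho> / 4)"
        unfolding abs_mult by (intro mult_mono t01 \<gamma>) auto
      then have "\<bar>\<alpha> + t * \<gamma>\<bar> \<le> \<delta> / 32"
        using \<alpha> \<rho> by linarith
      moreover have "\<bar>l\<bar> * (1/2) \<le> \<bar>l\<bar> * \<kappa>"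
        using \<kappa> by (intro mult_left_mono) auto
      moreover have l\<kappa>: "l * \<kappa> = \<alpha> + t * \<gamma>"
        using \<kappa> by (simp add: l_def \<mu>_def)
      then have "\<bar>l\<bar> * \<kappa> = \<bar>\<alpha> + t * \<gamma>\<bar>"
        using \<kappa> by (metis abs_mult abs_of_pos less_le_trans half_gt_zero zero_less_one)
      ultimately have l: "\<bar>l\<bar> \<le> \<delta> / 16"
        by linarith
      have lc: "norm ((2 * l / h) *\<^sub>R w) \<le> \<delta> / 64" if w: "norm w \<le> h / (8 * R)" for w :: "real^'n"
      proof -
        have "h / (8 * R) \<le> h / 8"
          using h R frac_le[of h h 8 "8 * R"] by simp
        then have "norm w / h \<le> 1/8"
          using w h by (simp add: field_simps)
        then have "(2 * \<bar>l\<bar>) * (norm w / h) \<le> (\<delta> / 8) * (1/8)"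
          using l h \<delta> by (intro mult_mono) auto
        then show ?thesis
          using h by (simp add: abs_mult)
      qed
      have uv: "norm u \<le> \<delta> / 20" "norm v \<le> \<delta> / 20"
        unfolding u_def v_def
        using norm_triangle_ineq[of x "(2 * l / h) *\<^sub>R c"] norm_triangle_ineq[of y "(2 * l / h) *\<^sub>R d"]
          lc[OF cd(1)] lc[OF cd(2)] x y \<rho> \<delta> by linarith+
      define q where "q = (b1 + t *\<^sub>R c + u, b2 + t *\<^sub>R d + v, b3 + t * h + 2 * l)"
      have At: "(A t - b3) / h = t + 2 * l / h"
        using h by (simp add: A_def l_def field_simps)
      have q: "(x + \<phi> (A t), y + \<psi> (A t), A t) = q"
        unfolding \<phi>_def \<psi>_def At q_def u_def v_def
        by (simp add: A_def l_def algebra_simps)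
      have "(b2 + t *\<^sub>R d) \<bullet> u - (b1 + t *\<^sub>R c) \<bullet> v = \<alpha> + t * \<gamma> + (2 * l / h) * \<omega>"
        unfolding u_def v_def \<alpha>_def \<gamma>_def \<omega>_def
        by (simp add: inner_simps algebra_simps inner_commute diff_divide_distrib)
      also have "\<dots> = l"
        unfolding l\<kappa>[symmetric] \<kappa>_def using h by (simp add: field_simps)
      finally have sy: "(b2 + t *\<^sub>R d) \<bullet> u - (b1 + t *\<^sub>R c) \<bullet> v = l" .
      have "q = heis_mult (t *\<^sub>R (c, d, h) + (b1, b2, b3)) (u, v, 0)"
        using sy by (simp add: q_def algebra_simps)
      then have qG: "q \<in> G"
        using sweep[OF t, of u v] uv \<delta> by simp
      define w where "w = (u, v, 2 * l)"
      have w: "norm w < \<delta> / 4"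
        unfolding w_def using norm_triple_le[of u v "2 * l"] uv l \<delta> by linarith
      have qa: "q - a = (t - 1/2) *\<^sub>R (c, d, h) + w"
        by (simp add: q_def a_def w_def algebra_simps)
      have ee: "(c, d, h) \<bullet> (c, d, h) = 1"
        using e by (metis norm_eq_1)
      have we: "\<bar>w \<bullet> (c, d, h)\<bar> \<le> norm w"
        using Cauchy_Schwarz_ineq2[of w "(c, d, h)"] e by simp
      have qe: "(q - a) \<bullet> (c, d, h) = (t - 1/2) + w \<bullet> (c, d, h)"
        unfolding qa inner_add_left inner_scaleR_left ee by simp
      then have "\<bar>(q - a) \<bullet> (c, d, h)\<bar> < 1/2"
        using t01 we w \<delta> by linarith
      moreover have "q - a - ((q - a) \<bullet> (c, d, h)) *\<^sub>R (c, d, h) = w - (w \<bullet> (c, d, h)) *\<^sub>R (c, d, h)"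
      proof -
        have "s *\<^sub>R E + z - (s + l) *\<^sub>R E = z - l *\<^sub>R E" for s l and E z :: "'n heis"
          unfolding scaleR_add_left by (simp only: add_diff_add diff_self add_0)
        then show ?thesis
          unfolding qe unfolding qa .
      qed
      moreover have "norm (w - (w \<bullet> (c, d, h)) *\<^sub>R (c, d, h)) \<le> norm w + norm w"
        using norm_triangle_ineq4[of w "(w \<bullet> (c, d, h)) *\<^sub>R (c, d, h)"] we
        unfolding norm_scaleR e by linarith
      ultimately have "q \<in> open_tube \<delta> (c, d, h) a"
        using w \<delta> unfolding open_tube_def by simp
      then show ?thesis
        unfolding q X_def using qG by blast
    qed
    define m where "m = h + 2 * (\<gamma> / \<kappa>)"
    have A: "A t = (b3 + 2 * \<alpha> / \<kappa>) + m * t" for t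
      by (simp add: A_def \<mu>_def m_def add_divide_distrib algebra_simps)
    have "1/2 \<le> h"
      using norm_triple_le[of c d h] e small h by simp
    moreover have "\<bar>\<gamma> / \<kappa>\<bar> \<le> \<rho> / 2"
    proof -
      have "\<bar>\<gamma>\<bar> / \<kappa> \<le> (\<rho> / 4) / (1/2)"
        using \<gamma> \<kappa> \<rho> by (intro frac_le) auto
      then show ?thesis
        using \<kappa> by (simp add: abs_divide)
    qed
    ultimately have m: "1/4 \<le> m"
      unfolding m_def using \<rho> \<delta> by linarith
    have [measurable]: "J \<in> sets borel" "\<phi> \<in> borel_measurable borel" "\<psi> \<in> borel_measurable borel"
      using J by (simp_all add: \<phi>_def \<psi>_def)
    have "ennreal (1/4) \<le> ennreal \<bar>m\<bar>"
      using m by (intro ennreal_leI) linarith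
    then have "ennreal (1/4) * emeasure lborel J \<le> ennreal \<bar>m\<bar> * emeasure lborel J"
      by (rule mult_right_mono) (rule zero_le)
    also have "\<dots> = ennreal \<bar>m\<bar> * (\<integral>\<^sup>+t. indicator J t \<partial>lborel)"
      using J(1) by simp
    also have "\<dots> \<le> ennreal \<bar>m\<bar> * (\<integral>\<^sup>+t. indicator X (x + \<phi> (A t), y + \<psi> (A t), A t) \<partial>lborel)"
    proof (rule mult_left_mono, rule nn_integral_mono)
      fix t
      show "indicator J t \<le> (indicator X (x + \<phi> (A t), y + \<psi> (A t), A t) :: ennreal)"
        using inX[of t] by (cases "t \<in> J") simp_all
    qed simp
    also have "\<dots> = (\<integral>\<^sup>+t. indicator X (x + \<phi> t, y + \<psi> t, t) \<partial>lborel)"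
      unfolding A
      by (rule nn_integral_real_affine[where f = "\<lambda>t. indicator X (x + \<phi> t, y + \<psi> t, t)", symmetric])
        (measurable, use m in linarith)
    finally show ?thesis .
  qed
  have [measurable]: "\<phi> \<in> borel_measurable borel" "\<psi> \<in> borel_measurable borel"
    by (simp_all add: \<phi>_def \<psi>_def)
  have "ennreal ((unit_ball_vol CARD('n) * \<rho> ^ CARD('n))\<^sup>2 / 4) * emeasure lborel J
      = emeasure lborel (cball (0 :: real^'n) \<rho>) *
        (emeasure lborel (cball (0 :: real^'n) \<rho>) * (ennreal (1/4) * emeasure lborel J))"
  proof -
    define \<nu> where "\<nu> = unit_ball_vol CARD('n) * \<rho> ^ CARD('n)"
    have "0 \<le> \<nu>"
      using \<rho> by (simp add: \<nu>_def)
    have "ennreal (\<nu>\<^sup>2 / 4) = ennreal \<nu> * (ennreal \<nu> * ennreal (1/4))"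
      using \<open>0 \<le> \<nu>\<close> by (subst ennreal_mult[symmetric], simp, simp)+ (simp add: power2_eq_square)
    moreover have "emeasure lborel (cball (0 :: real^'n) \<rho>) = ennreal \<nu>"
      using \<rho> by (simp add: emeasure_cball_cart \<nu>_def)
    ultimately show ?thesis
      unfolding \<nu>_def[symmetric] by (simp only: mult.assoc)
  qed
  also have "\<dots> = (\<integral>\<^sup>+x. \<integral>\<^sup>+y. indicator (cball (0 :: real^'n) \<rho>) x * (indicator (cball (0 :: real^'n) \<rho>) y *
      (ennreal (1/4) * emeasure lborel J)) \<partial>lborel \<partial>lborel)"
    by (rule nn_integral_indicator_box[symmetric]) simp_all
  also have "\<dots> \<le> (\<integral>\<^sup>+x. \<integral>\<^sup>+y. \<integral>\<^sup>+t. indicator X (x + \<phi> t, y + \<psi> t, t) \<partial>lborel \<partial>lborel \<partial>lborel)"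
  proof (intro nn_integral_mono)
    fix x y :: "real^'n"
    show "indicator (cball 0 \<rho>) x * (indicator (cball 0 \<rho>) y * (ennreal (1/4) * emeasure lborel J))
        \<le> (\<integral>\<^sup>+t. indicator X (x + \<phi> t, y + \<psi> t, t) \<partial>lborel)"
      using slice[of x y] by (cases "norm x \<le> \<rho>"; cases "norm y \<le> \<rho>") simp_all
  qed
  also have "\<dots> = (\<integral>\<^sup>+q. indicator X q \<partial>lborel)"
    by (rule nn_integral_heis_sheared[symmetric]) simp_all
  also have "\<dots> = emeasure lborel X"
    by simp
  finally show ?thesis
    unfolding X_def a_def \<rho>_def .
qed

section \<open>Powers of extended nonnegative reals\<close>

lemma ennreal_powr_ennreal: "0 \<le> x \<Longrightarrow> ennreal_powr (ennreal x) p = ennreal (x powr p)"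
  by (simp add: ennreal_powr_def)

lemma ennreal_powr_mono:
  assumes "x \<le> y" "0 \<le> p"
  shows "ennreal_powr x p \<le> ennreal_powr y p"
proof (cases "y = \<infinity>")
  case False
  then have "y < \<infinity>" "x < \<infinity>"
    using assms by (auto simp: less_top top_unique)
  then obtain a b where "x = ennreal a" "0 \<le> a" "y = ennreal b" "0 \<le> b"
    by (metis ennreal_enn2real enn2real_nonneg infinity_ennreal_def)
  with assms show ?thesis
    by (simp add: ennreal_powr_ennreal ennreal_leI powr_mono2)
qed (simp add: ennreal_powr_def)

section \<open>Hausdorff measures for the Heisenberg metric\<close>

lemma diam_heis_plate_le: "diam_wrt heis_dist (heis_plate p r) \<le> ennreal (4 * r)"
  unfolding diam_wrt_def
  by (intro SUP_least ennreal_leI heis_dist_le_if_mem_plate)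


lemma heis_plate_subset_cball:
  fixes p :: "'n::finite heis"
  assumes "norm p \<le> R" "0 \<le> r" "r \<le> 1"
  shows "heis_plate p r \<subseteq> cball 0 (4 * (R + 1)\<^sup>2 + 3 * R + 3)"
proof
  fix q assume q: "q \<in> heis_plate p r"
  obtain x y t where xyt: "q = (x, y, t)" by (metis prod_cases3)
  obtain a b c where p: "p = (a, b, c)" by (metis prod_cases3)
  have abc: "norm a \<le> R" "norm b \<le> R" "\<bar>c\<bar> \<le> R"
    using assms(1) norm_le_triple[where x = a and y = b and t = c] by (auto simp: p)
  have h: "norm (x - a) \<le> r" "norm (y - b) \<le> r" "\<bar>t - (c + 2 * (b \<bullet> x - a \<bullet> y))\<bar> \<le> r\<^sup>2"
    using q by (auto simp: xyt p mem_heis_plate)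
  have R: "0 \<le> R"
    using abc(3) by linarith
  have x: "norm x \<le> R + 1" and y: "norm y \<le> R + 1"
    using h(1,2) abc assms norm_triangle_sub[of x a] norm_triangle_sub[of y b] by linarith+
  have "\<bar>b \<bullet> x - a \<bullet> y\<bar> \<le> 2 * (R + 1) * (R + 1)"
    using abc x y by (intro abs_symplectic_le) auto
  then have "\<bar>b \<bullet> x - a \<bullet> y\<bar> \<le> 2 * (R + 1)\<^sup>2"
    unfolding power2_eq_square by (simp only: mult.assoc)
  moreover have "r\<^sup>2 \<le> 1"
    using assms by (simp add: power_le_one)
  moreover define S where "S = (R + 1)\<^sup>2"
  ultimately have "\<bar>t - (c + 2 * (b \<bullet> x - a \<bullet> y))\<bar> + \<bar>c\<bar> + 2 * \<bar>b \<bullet> x - a \<bullet> y\<bar> \<le> 1 + R + 2 * (2 * S)"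
    using h(3) abc(3) by (intro add_mono mult_left_mono) auto
  moreover have "\<bar>t\<bar> \<le> \<bar>t - (c + 2 * \<sigma>)\<bar> + \<bar>c\<bar> + 2 * \<bar>\<sigma>\<bar>" for \<sigma>
    by linarith
  ultimately have "\<bar>t\<bar> \<le> 1 + R + 2 * (2 * S)"
    by (rule order_trans[rotated])
  then have "norm q \<le> 4 * S + 3 * R + 3"
    using norm_triple_le[of x y t] x y unfolding xyt by simp
  then have "norm q \<le> 4 * (R + 1)\<^sup>2 + 3 * R + 3"
    by (simp only: S_def)
  then show "q \<in> cball 0 (4 * (R + 1)\<^sup>2 + 3 * R + 3)"
    by simp
qed

text \<open>
  Volume comparison: a largest family of disjoint plates of radius \<open>r\<close> centred in \<open>B\<close> has at most
  about \<open>r\<close> to the power \<open>- (2 n + 2)\<close> members, and by maximality the enlarged plates cover \<open>B\<close>.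
\<close>

lemma heis_plate_packing:
  fixes B :: "'n::finite heis set"
  assumes "bounded B"
  obtains K where "\<And>r. 0 < r \<Longrightarrow> r \<le> 1 \<Longrightarrow>
    \<exists>F\<subseteq>B. finite F \<and> B \<subseteq> (\<Union>p\<in>F. heis_plate p (3 * r)) \<and> real (card F) * r ^ (2 * CARD('n) + 2) \<le> K"
proof -
  obtain R where R: "\<And>q. q \<in> B \<Longrightarrow> norm q \<le> R"
    using assms by (auto simp: bounded_iff)
  define Q :: "'n heis set" where "Q = cball 0 (4 * (R + 1)\<^sup>2 + 3 * R + 3)"
  define M where "M = measure lborel Q"
  define v where "v = 2 * (unit_ball_vol CARD('n))\<^sup>2"
  have v: "0 < v"
    using unit_ball_vol_pos[of "real CARD('n)"] unfolding v_def by (simp del: unit_ball_vol_pos)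
  have Q: "emeasure lborel Q = ennreal M" "Q \<in> sets borel"
    unfolding M_def Q_def
    by (rule emeasure_eq_ennreal_measure, metis emeasure_lborel_cball_finite infinity_ennreal_def less_irrefl)
      simp
  show thesis
  proof (rule that)
    fix r :: real assume r: "0 < r" "r \<le> 1"
    define d where "d = 2 * CARD('n) + 2"
    define P where "P = (\<lambda>F. F \<subseteq> B \<and> finite F \<and> disjoint_family_on (\<lambda>p. heis_plate p r) F)"
    have card: "real (card F) * r ^ d \<le> M / v" if "P F" for F
    proof -
      have "ennreal (real (card F) * (v * r ^ d)) = (\<Sum>p\<in>F. emeasure lborel (heis_plate p r))"
        using r v by (simp add: emeasure_heis_plate v_def d_def ennreal_mult ennreal_of_nat_eq_real_of_nat)
      also have "\<dots> = emeasure lborel (\<Union>p\<in>F. heis_plate p r)"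
        using that by (intro sum_emeasure) (auto simp: P_def)
      also have "\<dots> \<le> emeasure lborel Q"
        using heis_plate_subset_cball[OF R, of _ r] that r Q(2)
        by (intro emeasure_mono) (fastforce simp: P_def Q_def)+
      finally have "real (card F) * (v * r ^ d) \<le> M"
        unfolding Q(1) by (subst (asm) ennreal_le_iff) (auto simp: M_def)
      then show ?thesis
        using v by (simp add: field_simps)
    qed
    have "\<exists>F. P F \<and> (\<forall>F'. P F' \<longrightarrow> card F' \<le> card F)"
    proof (rule Lattices_Big.ex_has_greatest_nat)
      show "P {}"
        by (simp add: P_def disjoint_family_on_def)
      show "\<forall>F. P F \<longrightarrow> card F < Suc (nat \<lceil>M / v / r ^ d\<rceil>)"
      proof (intro allI impI)
        fix F assume "P F"
        then have "real (card F) \<le> M / v / r ^ d"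
          using card[of F] r by (subst pos_le_divide_eq) auto
        then show "card F < Suc (nat \<lceil>M / v / r ^ d\<rceil>)"
          by linarith
      qed
    qed
    then obtain F where F: "P F" and max: "\<And>F'. P F' \<Longrightarrow> card F' \<le> card F"
      by blast
    have "q \<in> (\<Union>p\<in>F. heis_plate p (3 * r))" if q: "q \<in> B" for q
    proof -
      have self: "q \<in> heis_plate q r"
        using r by (cases q) (simp add: mem_heis_plate inner_commute)
      have "\<exists>p\<in>F. heis_plate p r \<inter> heis_plate q r \<noteq> {}"
      proof (cases "q \<in> F")
        case False
        show ?thesis
        proof (rule ccontr)
          assume "\<not> ?thesis"
          then have "P (insert q F)"
            using F q False by (auto simp: P_def disjoint_family_on_def)
          from max[OF this] show False
            using F False by (simp add: P_def)
        qed
      qed (use self in auto)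
      then show ?thesis
        using mem_plate_if_plates_meet by blast
    qed
    then show "\<exists>F\<subseteq>B. finite F \<and> B \<subseteq> (\<Union>p\<in>F. heis_plate p (3 * r)) \<and>
        real (card F) * r ^ (2 * CARD('n) + 2) \<le> M / v"
      using F card[OF F] by (auto simp: P_def d_def)
  qed
qed

text \<open>
  The packing bound gives covers with \<open>\<Sum> diam\<^sup>s\<close> of order \<open>r\<close> to the power \<open>s - (2 n + 2)\<close>.
\<close>

lemma hausdorff_measure_heis_eq_0:
  fixes B :: "'n::finite heis set"
  assumes "bounded B" and s: "2 * real CARD('n) + 2 < s"
  shows "hausdorff_measure heis_dist s B = 0"
proof -
  obtain K where K: "\<And>r. 0 < r \<Longrightarrow> r \<le> 1 \<Longrightarrow>
    \<exists>F\<subseteq>B. finite F \<and> B \<subseteq> (\<Union>p\<in>F. heis_plate p (3 * r)) \<and> real (card F) * r ^ (2 * CARD('n) + 2) \<le> K"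
    using heis_plate_packing[OF assms(1)] by blast
  define d where "d = 2 * CARD('n) + 2"
  have ds: "real d < s" "0 < s"
    using s by (auto simp: d_def)
  have "hausdorff_premeasure heis_dist s \<epsilon> B = 0" if \<epsilon>: "0 < \<epsilon>" for \<epsilon>
  proof -
    have bound: "hausdorff_premeasure heis_dist s \<epsilon> B \<le> ennreal (K * 12 powr s * r powr (s - d))"
      if r: "0 < r" "r < min 1 (\<epsilon> / 12)" for r
    proof -
      obtain F where F: "finite F" "B \<subseteq> (\<Union>p\<in>F. heis_plate p (3 * r))"
          "real (card F) * r ^ d \<le> K"
        using K[of r] r by (auto simp: d_def)
      obtain f where f: "bij_betw f {..<card F} F"
        using ex_bij_betw_nat_finite[OF F(1)] by (auto simp: atLeast0LessThan)
      define U where "U = (\<lambda>i. if i < card F then heis_plate (f i) (3 * r) else {})"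
      have diam: "diam_wrt heis_dist (U i) \<le> ennreal (12 * r)" for i
      proof (cases "i < card F")
        case True
        then show ?thesis
          using diam_heis_plate_le[of "f i" "3 * r"] by (simp add: U_def)
      qed (simp add: U_def diam_wrt_def bot_ennreal)
      have "(\<Union>p\<in>F. heis_plate p (3 * r)) \<subseteq> (\<Union>i. U i)"
      proof
        fix q assume "q \<in> (\<Union>p\<in>F. heis_plate p (3 * r))"
        then obtain p where p: "p \<in> F" "q \<in> heis_plate p (3 * r)"
          by (rule UN_E)
        then obtain i where "i < card F" "p = f i"
          using f by (auto simp: bij_betw_def)
        with p(2) show "q \<in> (\<Union>i. U i)"
          by (auto simp: U_def)
      qed
      with F(2) have "B \<subseteq> (\<Union>i. U i)"
        by blast
      moreover have "diam_wrt heis_dist (U i) \<le> ennreal \<epsilon>" for i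
        using diam[of i] by (rule order_trans) (use r in \<open>auto intro!: ennreal_leI\<close>)
      ultimately have "hausdorff_premeasure heis_dist s \<epsilon> B \<le> (\<Sum>i. diam_pow heis_dist s (U i))"
        unfolding hausdorff_premeasure_def by (intro INF_lower) blast
      also have "\<dots> = (\<Sum>i<card F. diam_pow heis_dist s (U i))"
        by (intro suminf_finite) (auto simp: U_def diam_pow_def)
      also have "\<dots> \<le> (\<Sum>i<card F. ennreal ((12 * r) powr s))"
      proof (intro sum_mono)
        fix i
        have "ennreal_powr (diam_wrt heis_dist (U i)) s \<le> ennreal_powr (ennreal (12 * r)) s"
          using diam ds by (intro ennreal_powr_mono) auto
        then show "diam_pow heis_dist s (U i) \<le> ennreal ((12 * r) powr s)"
          using ds r by (simp add: diam_pow_def ennreal_powr_ennreal)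
      qed
      also have "\<dots> = ennreal (real (card F) * (12 * r) powr s)"
        by (simp add: ennreal_mult ennreal_of_nat_eq_real_of_nat)
      also have "\<dots> \<le> ennreal (K * 12 powr s * r powr (s - d))"
      proof (rule ennreal_leI)
        have "real (card F) * (12 * r) powr s = (real (card F) * r ^ d) * (12 powr s * r powr (s - d))"
          using r by (simp add: powr_mult powr_diff powr_realpow)
        also have "\<dots> \<le> K * (12 powr s * r powr (s - d))"
          using F(3) by (intro mult_right_mono) auto
        finally show "real (card F) * (12 * r) powr s \<le> K * 12 powr s * r powr (s - d)"
          by (simp add: mult.assoc)
      qed
      finally show ?thesis .
    qed
    have "((\<lambda>r. r powr (s - d)) \<longlongrightarrow> 0) (at_right 0)"
      using ds by (intro tendsto_zero_powrI[where b = "s - d"])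
        (auto intro!: tendsto_eq_intros eventually_at_rightI[of 0 1])
    then have "((\<lambda>r. K * 12 powr s * r powr (s - d)) \<longlongrightarrow> 0) (at_right 0)"
      by (rule tendsto_mult_right_zero)
    then have lim: "((\<lambda>r. ennreal (K * 12 powr s * r powr (s - d))) \<longlongrightarrow> ennreal 0) (at_right 0)"
      by (rule tendsto_ennrealI)
    have "\<forall>\<^sub>F r in at_right 0. hausdorff_premeasure heis_dist s \<epsilon> B \<le> ennreal (K * 12 powr s * r powr (s - d))"
      by (rule eventually_at_rightI[of 0 "min 1 (\<epsilon> / 12)"]) (use bound \<epsilon> in auto)
    from tendsto_lowerbound[OF lim this] show ?thesis
      by simp
  qed
  then show ?thesis
    by (simp add: hausdorff_measure_def)
qed

lemma half_power_powr: "((1 / 2 :: real) ^ k) powr s = ((1 / 2) powr s) ^ k"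
  by (simp add: powr_realpow[symmetric] powr_powr mult.commute)

text \<open>
  Dyadic radii sort the cover into levels. The exponent is raised strictly above \<open>s\<^sub>0\<close> so that it is
  positive: then sets of diameter zero can be replaced by tiny plates at a tiny cost, also for the
  counting measure \<open>s\<^sub>0 = 0\<close>.
\<close>

lemma dyadic_cover_if_hausdorff_measure_0:
  fixes B :: "'n::finite heis set"
  assumes 0: "hausdorff_measure heis_dist s\<^sub>0 B = 0" and s: "0 \<le> s\<^sub>0" "s\<^sub>0 < s"
  obtains p :: "nat \<Rightarrow> 'n heis" and k :: "nat \<Rightarrow> nat"
  where "\<And>i. k\<^sub>0 \<le> k i" "B \<subseteq> (\<Union>i. heis_plate (p i) ((1/2) ^ k i))"
    "(\<Sum>i. ennreal (((1/2) ^ k i) powr s)) \<le> 1"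
proof -
  define \<epsilon> :: real where "\<epsilon> = (1/2) ^ k\<^sub>0"
  have \<epsilon>: "0 < \<epsilon>" "\<epsilon> \<le> 1"
    by (auto simp: \<epsilon>_def power_le_one)
  have "hausdorff_premeasure heis_dist s\<^sub>0 \<epsilon> B \<le> hausdorff_measure heis_dist s\<^sub>0 B"
    unfolding hausdorff_measure_def using \<epsilon> by (intro SUP_upper) auto
  then have "hausdorff_premeasure heis_dist s\<^sub>0 \<epsilon> B < ennreal (2 powr (- s) / 2)"
    unfolding 0 by (simp add: less_le_trans)
  then obtain U where U: "B \<subseteq> (\<Union>i. U i)" "\<And>i. diam_wrt heis_dist (U i) \<le> ennreal \<epsilon>"
      and sum: "(\<Sum>i. diam_pow heis_dist s\<^sub>0 (U i)) < ennreal (2 powr (- s) / 2)"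
    unfolding hausdorff_premeasure_def INF_less_iff by auto
  define \<eta> :: "nat \<Rightarrow> real" where "\<eta> i = (1/2) ^ Suc i / 2" for i
  \<comment> \<open>A set of diameter \<open>D > 0\<close> gets the dyadic radius in \<open>[D, 2 D)\<close>; the sets of diameter \<open>0\<close>, which
    have no natural radius, get tiny ones with a summable contribution.\<close>
  have ex: "\<exists>p k. k\<^sub>0 \<le> k \<and> U i \<subseteq> heis_plate p ((1/2) ^ k) \<and>
      ennreal (((1/2) ^ k) powr s) \<le> ennreal (2 powr s) * diam_pow heis_dist s\<^sub>0 (U i) + ennreal (\<eta> i)" for i
  proof -
    define D where "D = enn2real (diam_wrt heis_dist (U i))"
    have D: "diam_wrt heis_dist (U i) = ennreal D" "0 \<le> D" "D \<le> \<epsilon>"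
    proof -
      show *: "diam_wrt heis_dist (U i) = ennreal D"
        unfolding D_def using le_less_trans[OF U(2)[of i] ennreal_less_top]
        by (simp add: ennreal_enn2real)
      show "0 \<le> D" by (simp add: D_def)
      show "D \<le> \<epsilon>"
        using U(2)[of i] \<epsilon> unfolding * by (subst (asm) ennreal_le_iff) auto
    qed
    have sub: "\<exists>p. U i \<subseteq> heis_plate p r" if "D \<le> r" for r
    proof (cases "U i = {}")
      case False
      then obtain p where p: "p \<in> U i"
        by blast
      have "heis_dist q p \<le> D" if "q \<in> U i" for q
      proof -
        have "ennreal (heis_dist q p) \<le> diam_wrt heis_dist (U i)"
          unfolding diam_wrt_def by (rule SUP_upper2[OF that], rule SUP_upper2[OF p]) simp
        then show ?thesis
          unfolding D(1) using D(2) by simp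
      qed
      with \<open>D \<le> r\<close> show ?thesis
        by (intro exI[of _ p] subsetI heis_dist_le_imp_mem_plate) (rule order_trans)
    qed simp
    show ?thesis
    proof (cases "D = 0")
      case True
      have "(\<lambda>k. ((1/2) powr s) ^ k) \<longlonglongrightarrow> (0 :: real)"
        using s by (intro LIMSEQ_power_zero) (simp add: powr01_less_one)
      then have "\<forall>\<^sub>F k in sequentially. ((1/2 :: real) ^ k) powr s < \<eta> i"
        unfolding half_power_powr by (rule order_tendstoD(2)) (simp add: \<eta>_def)
      then obtain k where k: "k\<^sub>0 \<le> k" "((1/2 :: real) ^ k) powr s < \<eta> i"
        using eventually_happens'[OF sequentially_bot eventually_conj[OF eventually_ge_at_top[of k\<^sub>0]]] by auto
      have "ennreal (((1/2) ^ k) powr s) \<le> ennreal (\<eta> i)"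
        using k by (intro ennreal_leI) simp
      also have "\<dots> \<le> ennreal (2 powr s) * diam_pow heis_dist s\<^sub>0 (U i) + ennreal (\<eta> i)"
        by simp
      finally have "ennreal (((1/2) ^ k) powr s) \<le>
        ennreal (2 powr s) * diam_pow heis_dist s\<^sub>0 (U i) + ennreal (\<eta> i)" .
      moreover have "D \<le> (1/2) ^ k"
        using True by simp
      ultimately show ?thesis
        using k(1) sub by blast
    next
      case False
      then have Dpos: "0 < D"
        using D by simp
      define m where "m = (LEAST m. (1/2 :: real) ^ m < D)"
      have ex_m: "\<exists>m. (1/2 :: real) ^ m < D"
        using real_arch_pow_inv[OF Dpos, of "1/2"] by simp
      have m: "(1/2 :: real) ^ m < D"
        unfolding m_def by (rule LeastI_ex[OF ex_m])
      have "k\<^sub>0 < m"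
      proof (rule ccontr)
        assume "\<not> k\<^sub>0 < m"
        then have "\<epsilon> \<le> (1/2 :: real) ^ m"
          unfolding \<epsilon>_def by (intro power_decreasing) auto
        with m D show False by simp
      qed
      then obtain k where k: "m = Suc k" "k\<^sub>0 \<le> k"
        by (cases m) auto
      have Dk: "D \<le> (1/2) ^ k"
        using not_less_Least[of k "\<lambda>m. (1/2 :: real) ^ m < D"] k(1) unfolding m_def[symmetric] by simp
      have ne: "U i \<noteq> {}"
        using Dpos D(1) by (auto simp: diam_wrt_def bot_ennreal)
      have "((1/2) ^ k) powr s \<le> (2 * D) powr s"
        using m s unfolding k(1) by (intro powr_mono2) auto
      also have "\<dots> = 2 powr s * D powr s"
        using Dpos by (simp add: powr_mult)
      also have "\<dots> \<le> 2 powr s * D powr s\<^sub>0"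
        using Dpos D \<epsilon> s by (intro mult_left_mono powr_mono') auto
      finally have "ennreal (((1/2) ^ k) powr s) \<le> ennreal (2 powr s * D powr s\<^sub>0)"
        by (rule ennreal_leI)
      also have "\<dots> = ennreal (2 powr s) * diam_pow heis_dist s\<^sub>0 (U i)"
        using ne Dpos by (simp add: diam_pow_def D(1) ennreal_powr_ennreal ennreal_mult)
      also have "\<dots> \<le> ennreal (2 powr s) * diam_pow heis_dist s\<^sub>0 (U i) + ennreal (\<eta> i)"
        by simp
      finally show ?thesis
        using k(2) sub[OF Dk] by blast
    qed
  qed
  from choice[OF allI[OF ex]] obtain p where "\<forall>i. \<exists>k. k\<^sub>0 \<le> k \<and> U i \<subseteq> heis_plate (p i) ((1/2) ^ k) \<and>
      ennreal (((1/2) ^ k) powr s) \<le> ennreal (2 powr s) * diam_pow heis_dist s\<^sub>0 (U i) + ennreal (\<eta> i)" ..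
  from choice[OF this] obtain k where pk: "\<And>i. k\<^sub>0 \<le> k i" "\<And>i. U i \<subseteq> heis_plate (p i) ((1/2) ^ k i)"
    "\<And>i. ennreal (((1/2) ^ k i) powr s) \<le> ennreal (2 powr s) * diam_pow heis_dist s\<^sub>0 (U i) + ennreal (\<eta> i)"
    by blast
  have \<eta>_sum: "(\<Sum>i. ennreal (\<eta> i)) = ennreal (1 / 2)"
  proof (rule suminf_ennreal_eq)
    show "\<eta> sums (1 / 2)"
      using sums_divide[OF power_half_series, of 2] by (simp add: \<eta>_def[abs_def])
  qed (simp add: \<eta>_def)
  have "(\<Sum>i. ennreal (((1/2) ^ k i) powr s)) \<le>
      (\<Sum>i. ennreal (2 powr s) * diam_pow heis_dist s\<^sub>0 (U i) + ennreal (\<eta> i))"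
    using pk(3) by (intro suminf_le) auto
  also have "\<dots> = ennreal (2 powr s) * (\<Sum>i. diam_pow heis_dist s\<^sub>0 (U i)) + (\<Sum>i. ennreal (\<eta> i))"
    by (subst suminf_add[symmetric]) auto
  also have "\<dots> \<le> ennreal (2 powr s) * ennreal (2 powr (- s) / 2) + ennreal (1 / 2)"
    unfolding \<eta>_sum using sum by (intro add_right_mono mult_left_mono) auto
  also have "ennreal (2 powr s) * ennreal (2 powr (- s) / 2) = ennreal (1 / 2)"
    by (subst ennreal_mult[symmetric]) (auto simp: powr_minus)
  also have "ennreal (1 / 2) + ennreal (1 / 2) = 1"
    by (subst ennreal_plus[symmetric]) auto
  finally have "(\<Sum>i. ennreal (((1/2) ^ k i) powr s)) \<le> 1" .
  moreover have "B \<subseteq> (\<Union>i. heis_plate (p i) ((1/2) ^ k i))"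
    by (rule order_trans[OF U(1)]) (intro UN_mono order_refl pk(2))
  ultimately show thesis
    using pk(1) by (intro that[of k p])
qed

lemma ennreal_powr_mult:
  assumes "0 \<le> a" "x < \<infinity>" "0 < p"
  shows "ennreal_powr (ennreal a * x) p = ennreal (a powr p) * ennreal_powr x p"
proof -
  obtain g where "x = ennreal g" "0 \<le> g"
    using assms(2) by (metis ennreal_enn2real enn2real_nonneg infinity_ennreal_def)
  with assms show ?thesis
    by (simp add: ennreal_mult[symmetric] ennreal_powr_ennreal powr_mult)
qed

lemma ennreal_powr_powr_inverse:
  assumes "0 < p"
  shows "ennreal_powr (ennreal_powr x (1 / p)) p = x"
proof (cases "x = \<infinity>")
  case False
  then obtain g where "x = ennreal g" "0 \<le> g"
    by (metis ennreal_enn2real enn2real_nonneg infinity_ennreal_def less_top)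
  with assms show ?thesis
    by (simp add: ennreal_powr_ennreal powr_powr powr_one)
qed (simp add: ennreal_powr_def)

lemma ennreal_powr_less_top: "x < \<infinity> \<Longrightarrow> ennreal_powr x p < \<infinity>"
  by (auto simp: ennreal_powr_def)

lemma ennreal_inverse_antimono:
  fixes x y :: ennreal
  assumes "x \<le> y"
  shows "inverse y \<le> inverse x"
proof -
  have "0 \<le> enn2ereal x" "enn2ereal x \<le> enn2ereal y"
    using assms by (simp_all add: enn2ereal_nonneg less_eq_ennreal.rep_eq)
  then show ?thesis
    by (simp add: less_eq_ennreal.rep_eq inverse_ennreal.rep_eq ereal_inverse_antimono)
qed

lemma sets_sphere_measure:
  "sets (sphere_measure :: 'a::euclidean_space measure) = sets (restrict_space borel (sphere 0 1))"
  by (simp add: sphere_measure_def)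

section \<open>Directions with rich tubes\<close>

text \<open>
  Chebyshev's inequality for the maximal estimate. The bound from below concerns a measurable set \<open>S\<close>
  of directions instead of a superlevel set of the maximal function, so that no measurability of the
  maximal function enters: the integral of its \<open>p\<close>-th power is at least that of the measurable
  function \<open>\<mu>\<^sup>p\<close> on \<open>S\<close>.
\<close>

lemma kakeya_weak_type:
  assumes est: "kakeya_maximal_estimate TYPE('a::euclidean_space) p \<beta>" and p: "0 < p"
  obtains C where "0 \<le> C"
    "\<And>G :: 'a set. \<And>\<delta> \<mu> S. G \<in> sets borel \<Longrightarrow> emeasure lborel G < \<infinity> \<Longrightarrow> 0 < \<delta> \<Longrightarrow> \<delta> < 1 \<Longrightarrow> 0 \<le> \<mu> \<Longrightarrow>
      S \<in> sets sphere_measure \<Longrightarrow> (\<And>e. e \<in> S \<Longrightarrow> ennreal \<mu> \<le> kakeya_maximal \<delta> (indicator G) e) \<Longrightarrow>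
      ennreal (\<mu> powr p) * emeasure sphere_measure S \<le> ennreal (C * \<delta> powr (- \<beta> * p)) * emeasure lborel G"
proof -
  obtain C where C: "\<And>f :: 'a \<Rightarrow> real. \<And>\<delta>. f \<in> borel_measurable lebesgue \<Longrightarrow>
        Lp_norm lebesgue p (\<lambda>x. ennreal \<bar>f x\<bar>) < \<infinity> \<Longrightarrow> 0 < \<delta> \<Longrightarrow> \<delta> < 1 \<Longrightarrow>
        Lp_norm sphere_measure p (kakeya_maximal \<delta> f)
          \<le> ennreal (C * \<delta> powr (- \<beta>)) * Lp_norm lebesgue p (\<lambda>x. ennreal \<bar>f x\<bar>)"
    using est unfolding kakeya_maximal_estimate_def by blast
  show thesis
  proof (rule that)
    fix G :: "'a set" and \<delta> \<mu> :: real and S :: "'a set"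
    assume G: "G \<in> sets borel" "emeasure lborel G < \<infinity>" and \<delta>: "0 < \<delta>" "\<delta> < 1" and \<mu>: "0 \<le> \<mu>"
      and S: "S \<in> sets sphere_measure" and le: "\<And>e. e \<in> S \<Longrightarrow> ennreal \<mu> \<le> kakeya_maximal \<delta> (indicator G) e"
    let ?f = "kakeya_maximal \<delta> (indicator G)"
    have "ennreal_powr (ennreal \<bar>indicator G x\<bar>) p = indicator G x" for x
      using p by (auto simp: ennreal_powr_def indicator_def)
    then have norm_G: "Lp_norm lebesgue p (\<lambda>x. ennreal \<bar>indicator G x\<bar>) = ennreal_powr (emeasure lborel G) (1 / p)"
      using G(1) by (simp add: Lp_norm_def nn_integral_completion)
    have "indicator G \<in> borel_measurable (lebesgue :: 'a measure)"
      using G(1) by (intro borel_measurable_indicator) simp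
    from C[OF this _ \<delta>]
    have "Lp_norm sphere_measure p ?f
        \<le> ennreal (C * \<delta> powr (- \<beta>)) * ennreal_powr (emeasure lborel G) (1 / p)"
      unfolding norm_G using ennreal_powr_less_top[OF G(2)] by blast
    also have "\<dots> \<le> ennreal (\<bar>C\<bar> * \<delta> powr (- \<beta>)) * ennreal_powr (emeasure lborel G) (1 / p)"
      by (intro mult_right_mono ennreal_leI) auto
    finally have "ennreal_powr (Lp_norm sphere_measure p ?f) p
        \<le> ennreal_powr (ennreal (\<bar>C\<bar> * \<delta> powr (- \<beta>)) * ennreal_powr (emeasure lborel G) (1 / p)) p"
      using p by (intro ennreal_powr_mono) auto
    also have "\<dots> = ennreal ((\<bar>C\<bar> * \<delta> powr (- \<beta>)) powr p) * emeasure lborel G"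
      using p ennreal_powr_less_top[OF G(2)]
      by (subst ennreal_powr_mult) (auto simp: ennreal_powr_powr_inverse)
    also have "(\<bar>C\<bar> * \<delta> powr (- \<beta>)) powr p = \<bar>C\<bar> powr p * \<delta> powr (- \<beta> * p)"
      using \<delta> by (simp add: powr_mult powr_powr)
    finally have upper: "(\<integral>\<^sup>+e. ennreal_powr (?f e) p \<partial>sphere_measure)
        \<le> ennreal (\<bar>C\<bar> powr p * \<delta> powr (- \<beta> * p)) * emeasure lborel G"
      unfolding Lp_norm_def ennreal_powr_powr_inverse[OF p] .
    have "ennreal (\<mu> powr p) * emeasure sphere_measure S
        = (\<integral>\<^sup>+e. ennreal (\<mu> powr p) * indicator S e \<partial>sphere_measure)"
      using S by (simp add: nn_integral_cmult_indicator)
    also have "\<dots> \<le> (\<integral>\<^sup>+e. ennreal_powr (?f e) p \<partial>sphere_measure)"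
    proof (rule nn_integral_mono)
      fix e
      show "ennreal (\<mu> powr p) * indicator S e \<le> ennreal_powr (?f e) p"
        using ennreal_powr_mono[OF le, of e p] p \<mu> by (auto simp: ennreal_powr_ennreal indicator_def)
    qed
    also note upper
    finally show "ennreal (\<mu> powr p) * emeasure sphere_measure S
        \<le> ennreal (\<bar>C\<bar> powr p * \<delta> powr (- \<beta> * p)) * emeasure lborel G" .
  qed simp
qed

text \<open>
  The directions so close to the vertical axis that a segment in such a direction, based at a point of
  norm at most \<open>R\<close>, crosses all horizontal planes along it at an angle bounded from below.
\<close>

definition vertical_cap :: "real \<Rightarrow> 'n::finite heis set" where
  "vertical_cap R = {(c, d, h) \<in> sphere 0 1. 0 < h \<and> norm c < h / (8 * R) \<and> norm d < h / (8 * R)}"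

lemma vertical_cap_alt:
  "vertical_cap R = sphere 0 1 \<inter> {q. 0 < snd (snd q) \<and>
     norm (fst q) < snd (snd q) / (8 * R) \<and> norm (fst (snd q)) < snd (snd q) / (8 * R)}"
  by (auto simp: vertical_cap_def)

lemma vertical_cap_measurable: "(vertical_cap R :: 'n::finite heis set) \<in> sets borel"
proof -
  have "open {q :: 'n heis. 0 < snd (snd q) \<and>
     norm (fst q) < snd (snd q) / (8 * R) \<and> norm (fst (snd q)) < snd (snd q) / (8 * R)}"
    unfolding divide_inverse by (intro open_Collect_conj open_Collect_less continuous_intros)
  then show ?thesis
    unfolding vertical_cap_alt by (intro sets.Int borel_open borel_closed) auto
qed

text \<open>
  By polar coordinates this is the volume of a truncated open cone.
\<close>

lemma emeasure_vertical_cap_pos: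
  assumes R: "1 \<le> R"
  shows "0 < emeasure sphere_measure (vertical_cap R :: 'n::finite heis set)"
proof -
  define Q :: "'n heis set" where "Q = {q. 0 < snd (snd q) \<and>
     norm (fst q) < snd (snd q) / (8 * R) \<and> norm (fst (snd q)) < snd (snd q) / (8 * R)}"
  have Q: "open Q"
    unfolding Q_def divide_inverse by (intro open_Collect_conj open_Collect_less continuous_intros)
  have scale: "r *\<^sub>R q \<in> Q \<longleftrightarrow> q \<in> Q" if "0 < r" for r q
    using that R by (simp add: Q_def zero_less_mult_iff divide_simps mult_ac)
  have cone: "{r *\<^sub>R e |r e. 0 < r \<and> r \<le> 1 \<and> e \<in> vertical_cap R} = Q \<inter> cball 0 1" (is "?L = ?R")
  proof
    show "?L \<subseteq> ?R"
    proof
      fix q assume "q \<in> ?L"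
      then obtain r e where re: "q = r *\<^sub>R e" "0 < r" "r \<le> 1" "norm e = 1" "e \<in> Q"
        by (auto simp: vertical_cap_alt Q_def[symmetric])
      then have "norm q = r"
        by (simp only: norm_scaleR abs_of_pos mult_1_right)
      with re scale show "q \<in> ?R"
        by simp
    qed
    show "?R \<subseteq> ?L"
    proof
      fix q assume q: "q \<in> ?R"
      define r where "r = norm q"
      have "q \<noteq> 0"
        using q by (auto simp: Q_def)
      then have r: "0 < r" "r \<le> 1"
        using q by (auto simp: r_def)
      have "inverse r *\<^sub>R q \<in> Q"
        using q r scale by simp
      moreover have "norm (inverse r *\<^sub>R q) = 1"
        using r by (simp add: r_def)
      ultimately have "inverse r *\<^sub>R q \<in> vertical_cap R"
        by (simp add: vertical_cap_alt Q_def[symmetric])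
      moreover have "q = r *\<^sub>R (inverse r *\<^sub>R q)"
        using r by simp
      ultimately show "q \<in> ?L"
        using r by blast
    qed
  qed
  have "(0, 0, 1/2) \<in> Q \<inter> ball 0 1"
    using R by (simp add: Q_def norm_Pair)
  moreover have "open (Q \<inter> ball 0 1)"
    using Q by auto
  ultimately obtain \<epsilon> where \<epsilon>: "0 < \<epsilon>" "ball (0, 0, 1/2) \<epsilon> \<subseteq> Q \<inter> ball 0 1"
    by (meson open_contains_ball)
  have "0 < emeasure lborel (ball (0 :: real^'n, 0 :: real^'n, 1/2 :: real) \<epsilon>)"
    using \<epsilon>(1) by (simp add: emeasure_ball unit_ball_vol_pos)
  also have "\<dots> \<le> emeasure lborel (Q \<inter> cball 0 1)"
    using \<epsilon>(2) Q by (intro emeasure_mono) auto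
  finally have "0 < emeasure lborel (Q \<inter> cball 0 1)" .
  moreover have "emeasure sphere_measure (vertical_cap R :: 'n heis set) =
      of_nat DIM('n heis) * emeasure lborel (Q \<inter> cball 0 1)"
    unfolding cone[symmetric]
    by (rule emeasure_sphere_measure[OF vertical_cap_measurable]) (auto simp: vertical_cap_def)
  moreover have "(0 :: ennreal) < of_nat DIM('n heis)"
    unfolding ennreal_of_nat_eq_real_of_nat 
    by (simp only: ennreal_less_zero_iff of_nat_0_less_iff DIM_positive)
  ultimately show ?thesis
    by (simp only: ennreal_zero_less_mult_iff)
qed

text \<open>
  The segments of a Besicovitch set may depend on the direction in a nonmeasurable way. Asking only for
  some tube that is rich in \<open>G\<close> gives a measurable set that contains all directions of interest.
\<close>

definition rich_directions :: "real \<Rightarrow> real \<Rightarrow> real \<Rightarrow> 'n::finite heis set \<Rightarrow> 'n heis set" where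
  "rich_directions R \<delta> m G =
     {e \<in> vertical_cap R. \<exists>a. ennreal m < emeasure lborel (open_tube \<delta> e a \<inter> G)}"

lemma rich_directions_measurable:
  assumes "G \<in> sets borel"
  shows "rich_directions R \<delta> m G \<in> sets sphere_measure"
proof -
  have "rich_directions R \<delta> m G =
      vertical_cap R \<inter> (\<Union>a. {e. ennreal m < emeasure lborel (open_tube \<delta> e a \<inter> G)})"
    by (auto simp: rich_directions_def)
  also have "\<dots> \<in> sets borel"
    using open_directions_large_open_tube[OF assms]
    by (intro sets.Int vertical_cap_measurable borel_open open_UN) auto
  finally have "rich_directions R \<delta> m G \<in> sets borel" .
  moreover have "rich_directions R \<delta> m G \<subseteq> sphere 0 1"
    by (auto simp: rich_directions_def vertical_cap_def)
  ultimately show ?thesis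
    unfolding sets_sphere_measure by (auto simp: sets_restrict_space_iff)
qed

text \<open>
  If a tube of width \<open>\<delta>\<close> meets \<open>G\<close> in measure above \<open>\<mu> \<delta>\<^sup>2\<^sup>n\<close>, the average of the indicator function
  of \<open>G\<close> over the tube is at least a constant times \<open>\<mu>\<close>.
\<close>

lemma emeasure_rich_directions_le:
  assumes est: "kakeya_maximal_estimate TYPE('n::finite heis) p \<beta>" and p: "0 < p" and R: "1 \<le> R"
  obtains K where "0 \<le> K"
    "\<And>G :: 'n heis set. \<And>\<delta> \<mu>. G \<in> sets borel \<Longrightarrow> emeasure lborel G < \<infinity> \<Longrightarrow> 0 < \<delta> \<Longrightarrow> \<delta> < 1 \<Longrightarrow> 0 \<le> \<mu> \<Longrightarrow>
      ennreal (\<mu> powr p) * emeasure sphere_measure (rich_directions R \<delta> (\<mu> * \<delta> ^ (2 * CARD('n))) G)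
        \<le> ennreal (K * \<delta> powr (- \<beta> * p)) * emeasure lborel G"
proof -
  obtain C where C: "0 \<le> C"
    "\<And>G :: 'n heis set. \<And>\<delta> \<mu> S. G \<in> sets borel \<Longrightarrow> emeasure lborel G < \<infinity> \<Longrightarrow> 0 < \<delta> \<Longrightarrow> \<delta> < 1 \<Longrightarrow> 0 \<le> \<mu> \<Longrightarrow>
      S \<in> sets sphere_measure \<Longrightarrow> (\<And>e. e \<in> S \<Longrightarrow> ennreal \<mu> \<le> kakeya_maximal \<delta> (indicator G) e) \<Longrightarrow>
      ennreal (\<mu> powr p) * emeasure sphere_measure S \<le> ennreal (C * \<delta> powr (- \<beta> * p)) * emeasure lborel G"
    using kakeya_weak_type[OF est p] by blast
  define v where "v = 3 * (unit_ball_vol CARD('n) * 2 ^ CARD('n))\<^sup>2"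
  have v: "0 < v"
    using unit_ball_vol_pos[of "real CARD('n)"] unfolding v_def by (simp del: unit_ball_vol_pos)
  show thesis
  proof (rule that)
    show "0 \<le> v powr p * C"
      using C(1) by simp
    fix G :: "'n heis set" and \<delta> \<mu> :: real
    assume G: "G \<in> sets borel" "emeasure lborel G < \<infinity>" and \<delta>: "0 < \<delta>" "\<delta> < 1" and \<mu>: "0 \<le> \<mu>"
    define S where "S = rich_directions R \<delta> (\<mu> * \<delta> ^ (2 * CARD('n))) G"
    have "ennreal (\<mu> / v) \<le> kakeya_maximal \<delta> (indicator G) e" if e: "e \<in> S" for e
    proof -
      obtain a where a: "ennreal (\<mu> * \<delta> ^ (2 * CARD('n))) < emeasure lborel (open_tube \<delta> e a \<inter> G)"
        using e by (auto simp: S_def rich_directions_def)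
      obtain c d h where cdh: "e = (c, d, h)" by (metis prod_cases3)
      have "(c, d, h) \<in> vertical_cap R"
        using e by (simp add: S_def rich_directions_def cdh)
      then have h: "norm (c, d, h) = 1" "0 < h" "norm c < h / (8 * R)" "norm d < h / (8 * R)"
        by (auto simp: vertical_cap_def)
      have "h / (8 * R) \<le> h / 1"
        using R h(2) by (intro divide_left_mono) auto
      then have ch: "norm c \<le> h" "norm d \<le> h"
        using h by linarith+
      have tube: "emeasure lborel (tube \<delta> e a) \<le> ennreal (v * \<delta> ^ (2 * CARD('n)))"
      proof -
        have "3 * (unit_ball_vol CARD('n) * (2 * \<delta>) ^ CARD('n))\<^sup>2 = v * \<delta> ^ (2 * CARD('n))"
          unfolding v_def power_even_eq power_mult_distrib by simp
        then show ?thesis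
          using emeasure_steep_tube_le[OF h(1,2) ch \<delta>, of a] by (simp only: cdh)
      qed
      have "ennreal (\<mu> / v) = ennreal (\<mu> * \<delta> ^ (2 * CARD('n))) / ennreal (v * \<delta> ^ (2 * CARD('n)))"
        using v \<delta> \<mu> by (subst divide_ennreal) auto
      also have "\<dots> \<le> emeasure lborel (tube \<delta> e a \<inter> G) / emeasure lborel (tube \<delta> e a)"
        unfolding divide_ennreal_def
      proof (intro mult_mono)
        have "emeasure lborel (open_tube \<delta> e a \<inter> G) \<le> emeasure lborel (tube \<delta> e a \<inter> G)"
          using open_tube_subset_tube[of \<delta> e a] G(1) by (intro emeasure_mono) auto
        with a show "ennreal (\<mu> * \<delta> ^ (2 * CARD('n))) \<le> emeasure lborel (tube \<delta> e a \<inter> G)"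
          by simp
        show "inverse (ennreal (v * \<delta> ^ (2 * CARD('n)))) \<le> inverse (emeasure lborel (tube \<delta> e a))"
          using tube by (rule ennreal_inverse_antimono)
      qed simp_all
      also have "\<dots> = (\<integral>\<^sup>+q\<in>tube \<delta> e a. ennreal \<bar>indicator G q\<bar> \<partial>lebesgue) / emeasure lebesgue (tube \<delta> e a)"
      proof -
        have "(\<integral>\<^sup>+q\<in>tube \<delta> e a. ennreal \<bar>indicator G q\<bar> \<partial>lebesgue)
            = (\<integral>\<^sup>+q. indicator (tube \<delta> e a \<inter> G) q \<partial>lebesgue)"
          by (intro nn_integral_cong) (auto simp: indicator_def)
        then show ?thesis
          using G(1) by (simp add: nn_integral_completion)
      qed
      also have "\<dots> \<le> kakeya_maximal \<delta> (indicator G) e"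
        unfolding kakeya_maximal_def by (rule SUP_upper) simp
      finally show ?thesis .
    qed
    then have "ennreal ((\<mu> / v) powr p) * emeasure sphere_measure S
        \<le> ennreal (C * \<delta> powr (- \<beta> * p)) * emeasure lborel G"
      using v \<mu> G \<delta> by (intro C(2)) (auto simp: S_def intro: rich_directions_measurable)
    then have "ennreal (v powr p) * (ennreal ((\<mu> / v) powr p) * emeasure sphere_measure S)
        \<le> ennreal (v powr p) * (ennreal (C * \<delta> powr (- \<beta> * p)) * emeasure lborel G)"
      by (rule mult_left_mono) simp
    then show "ennreal (\<mu> powr p) * emeasure sphere_measure (rich_directions R \<delta> (\<mu> * \<delta> ^ (2 * CARD('n))) G)
        \<le> ennreal (v powr p * C * \<delta> powr (- \<beta> * p)) * emeasure lborel G"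
      using v \<mu> C(1)
      by (simp add: S_def mult.assoc[symmetric] ennreal_mult[symmetric] powr_divide)
  qed
qed

section \<open>The dimension bounds\<close>

text \<open>
  A plate of radius \<open>\<delta>\<close> has volume about \<open>\<delta>\<close> to the power \<open>2 n + 2\<close>, and the bound on the sum lets at
  most \<open>\<delta>\<close> to the power \<open>- s\<close> indices have the radius \<open>\<delta>\<close>.
\<close>

lemma emeasure_Union_heis_plates_le:
  fixes p :: "nat \<Rightarrow> 'n::finite heis"
  assumes \<delta>: "0 < \<delta>" and sum: "(\<Sum>i. ennreal (r i powr s)) \<le> 1" and I: "\<And>i. i \<in> I \<Longrightarrow> r i = \<delta>"
  shows "emeasure lborel (\<Union>i\<in>I. heis_plate (p i) (3 * \<delta>)) \<le>
    ennreal (2 * (unit_ball_vol CARD('n))\<^sup>2 * 3 ^ (2 * CARD('n) + 2) * \<delta> powr (real (2 * CARD('n) + 2) - s))"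
    (is "_ \<le> ennreal ?K")
proof -
  define f where "f = (\<lambda>i. if i \<in> I then heis_plate (p i) (3 * \<delta>) else {})"
  have "emeasure lborel (f i) \<le> ennreal ?K * ennreal (r i powr s)" for i
  proof (cases "i \<in> I")
    case True
    have "\<delta> powr (real D - s) * \<delta> powr s = \<delta> ^ D" for D
      using \<delta> by (simp add: powr_add[symmetric] powr_realpow)
    then have eq: "2 * (unit_ball_vol CARD('n))\<^sup>2 * (3 * \<delta>) ^ (2 * CARD('n) + 2) = ?K * r i powr s"
      unfolding I[OF True] power_mult_distrib by (simp only: mult.assoc)
    have "emeasure lborel (f i) = emeasure lborel (heis_plate (p i) (3 * \<delta>))"
      using True by (simp only: f_def if_True)
    also have "\<dots> = ennreal (?K * r i powr s)"
      unfolding eq[symmetric] by (rule emeasure_heis_plate) (use \<delta> in simp)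
    also have "\<dots> = ennreal ?K * ennreal (r i powr s)"
      by (rule ennreal_mult) auto
    finally show ?thesis
      by simp
  qed (simp add: f_def)
  then have "(\<Sum>i. emeasure lborel (f i)) \<le> (\<Sum>i. ennreal ?K * ennreal (r i powr s))"
    by (intro suminf_le) auto
  also have "\<dots> = ennreal ?K * (\<Sum>i. ennreal (r i powr s))"
    by simp
  also have "\<dots> \<le> ennreal ?K * 1"
    using sum by (rule mult_left_mono) simp
  finally have "(\<Sum>i. emeasure lborel (f i)) \<le> ennreal ?K"
    by simp
  moreover have "(\<Union>i\<in>I. heis_plate (p i) (3 * \<delta>)) = (\<Union>i. f i)"
    by (auto simp: f_def split: if_splits)
  moreover have "emeasure lborel (\<Union>i. f i) \<le> (\<Sum>i. emeasure lborel (f i))"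
    by (intro emeasure_subadditive_countably) (auto simp: f_def)
  ultimately show ?thesis
    by simp
qed

text \<open>
  Pigeonhole principle over the levels, with a geometric budget of total size below \<open>1/2\<close>.
\<close>

lemma exists_level_if_half_interval_covered:
  fixes P :: "nat \<Rightarrow> real set"
  assumes P [measurable]: "\<And>j. P j \<in> sets borel" and cover: "{a..a + 1/2} \<subseteq> (\<Union>j. P j)"
    and \<theta>: "0 \<le> \<theta>" "\<theta> < 1" "\<theta> ^ k\<^sub>0 / (1 - \<theta>) < 1/2"
  obtains j where "ennreal (\<theta> ^ (k\<^sub>0 + j)) < emeasure lborel ({a..a + 1/2} \<inter> P j)"
proof (rule ccontr)
  assume "\<not> thesis"
  then have le: "emeasure lborel ({a..a + 1/2} \<inter> P j) \<le> ennreal (\<theta> ^ (k\<^sub>0 + j))" for j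
    using that by (meson not_less)
  have "(\<lambda>j. \<theta> ^ k\<^sub>0 * \<theta> ^ j) sums (\<theta> ^ k\<^sub>0 * (1 / (1 - \<theta>)))"
    using \<theta> by (intro sums_mult geometric_sums) auto
  then have sums: "(\<lambda>j. \<theta> ^ (k\<^sub>0 + j)) sums (\<theta> ^ k\<^sub>0 / (1 - \<theta>))"
    by (simp add: power_add)
  have "ennreal (1/2) = emeasure lborel {a..a + 1/2}"
    by simp
  also have "{a..a + 1/2} = (\<Union>j. {a..a + 1/2} \<inter> P j)"
    using cover by blast
  also have "emeasure lborel \<dots> \<le> (\<Sum>j. emeasure lborel ({a..a + 1/2} \<inter> P j))"
    by (intro emeasure_subadditive_countably) auto
  also have "\<dots> \<le> (\<Sum>j. ennreal (\<theta> ^ (k\<^sub>0 + j)))"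
    using le by (intro suminf_le) auto
  also have "\<dots> = ennreal (\<theta> ^ k\<^sub>0 / (1 - \<theta>))"
    using \<theta> sums by (intro suminf_ennreal_eq) auto
  also have "\<dots> < ennreal (1/2)"
    using \<theta> by (intro ennreal_lessI) auto
  finally show False by simp
qed

lemma emeasure_le_geometric_if_covered:
  assumes S: "\<And>j. S j \<in> sets M" "E \<subseteq> (\<Union>j. S j)"
    and le: "\<And>j. emeasure M (S j) \<le> ennreal (K * x ^ (k\<^sub>0 + j))" and x: "0 \<le> K" "0 \<le> x" "x < 1"
  shows "emeasure M E \<le> ennreal (K * x ^ k\<^sub>0 / (1 - x))"
proof -
  have "(\<lambda>j. K * x ^ k\<^sub>0 * x ^ j) sums (K * x ^ k\<^sub>0 * (1 / (1 - x)))"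
    using x by (intro sums_mult geometric_sums) auto
  then have sums: "(\<lambda>j. K * x ^ (k\<^sub>0 + j)) sums (K * x ^ k\<^sub>0 / (1 - x))"
    by (simp add: power_add mult.assoc)
  have "emeasure M E \<le> emeasure M (\<Union>j. S j)"
    using S by (intro emeasure_mono) auto
  also have "\<dots> \<le> (\<Sum>j. emeasure M (S j))"
    using S(1) by (intro emeasure_subadditive_countably) auto
  also have "\<dots> \<le> (\<Sum>j. ennreal (K * x ^ (k\<^sub>0 + j)))"
    using le by (intro suminf_le) auto
  also have "\<dots> = ennreal (K * x ^ k\<^sub>0 / (1 - x))"
    using x sums by (intro suminf_ennreal_eq) auto
  finally show ?thesis .
qed

text \<open>
  Suppose the measure vanishes, and pick \<open>s\<close> halfway between \<open>s\<^sub>0\<close> and \<open>2 n + 2 - \<beta> p\<close>. On each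
  segment of \<open>B\<close> in a direction of the vertical cap, some level \<open>k\<close> of a dyadic cover has plates that
  contain a length above \<open>\<theta>\<^sup>k\<close>. By sweeping, the plates of level \<open>k\<close>, enlarged by the factor \<open>3\<close>, fill a
  proportion of order \<open>\<theta>\<^sup>k\<close> of a tube of width \<open>\<delta> = 1/2\<^sup>k\<close>. Their total volume is at most \<open>\<delta>\<close> to the power
  \<open>2 n + 2 - s\<close>, up to constants, and the weak type estimate bounds the measure of the set of directions
  with this property by \<open>\<delta>\<close> to the power \<open>2 n + 2 - s - \<beta> p = \<alpha>\<close>, divided by \<open>\<theta>\<close> to the power
  \<open>k p\<close>. The sum over all levels \<open>k \<ge> k\<^sub>0\<close> of a fine cover is smaller than the measure of the cap,
  although these sets of directions cover the cap.
\<close>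

lemma hausdorff_measure_ne_0_if_kakeya_maximal_estimate:
  fixes B :: "'n::finite heis set"
  assumes est: "kakeya_maximal_estimate TYPE('n heis) p \<beta>" and p: "0 < p"
    and bdd: "bounded B" and segs: "\<And>e. e \<in> sphere 0 1 \<Longrightarrow> \<exists>b. (\<lambda>t. t *\<^sub>R e + b) ` {0..1} \<subseteq> B"
    and s\<^sub>0: "0 \<le> s\<^sub>0" "s\<^sub>0 < 2 * real CARD('n) + 2 - \<beta> * p"
  shows "hausdorff_measure heis_dist s\<^sub>0 B \<noteq> 0"
proof
  assume null: "hausdorff_measure heis_dist s\<^sub>0 B = 0"
  define d where "d = real (2 * CARD('n) + 2)"
  define s where "s = (s\<^sub>0 + (d - \<beta> * p)) / 2"
  define \<alpha> where "\<alpha> = d - \<beta> * p - s"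
  have s: "s\<^sub>0 < s" and \<alpha>: "0 < \<alpha>"
    using s\<^sub>0 by (auto simp: s_def \<alpha>_def d_def)
  \<comment> \<open>Level \<open>k\<close> may claim a length of \<open>\<theta> ^ k\<close> on each segment, and then occupies a set of directions of
    measure \<open>O(x ^ k)\<close>: half of the surplus \<open>\<alpha>\<close> pays for the former.\<close>
  define \<theta> x :: real where "\<theta> = (1/2) powr (\<alpha> / (2 * p))" and "x = (1/2) powr (\<alpha> / 2)"
  have \<theta>: "0 < \<theta>" "\<theta> < 1" and x: "0 < x" "x < 1"
    using \<alpha> p by (auto simp: \<theta>_def x_def powr01_less_one)
  obtain R0 where R0: "\<And>q. q \<in> B \<Longrightarrow> norm q \<le> R0"
    using bdd by (auto simp: bounded_iff)
  define R where "R = max 1 R0"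
  have R: "1 \<le> R" "\<And>q. q \<in> B \<Longrightarrow> norm q \<le> R"
    unfolding R_def by (rule max.cobounded1) (rule max.coboundedI2[OF R0])
  obtain K where K: "0 \<le> K"
    "\<And>G :: 'n heis set. \<And>\<delta> \<mu>. G \<in> sets borel \<Longrightarrow> emeasure lborel G < \<infinity> \<Longrightarrow> 0 < \<delta> \<Longrightarrow> \<delta> < 1 \<Longrightarrow> 0 \<le> \<mu> \<Longrightarrow>
      ennreal (\<mu> powr p) * emeasure sphere_measure (rich_directions R \<delta> (\<mu> * \<delta> ^ (2 * CARD('n))) G)
        \<le> ennreal (K * \<delta> powr (- \<beta> * p)) * emeasure lborel G"
    using emeasure_rich_directions_le[OF est p R(1)] by blast
  define c1 where "c1 = (unit_ball_vol CARD('n) * (1 / (80 * R)) ^ CARD('n))\<^sup>2 / 4"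
  define K1 where "K1 = 2 * (unit_ball_vol CARD('n))\<^sup>2 * 3 ^ (2 * CARD('n) + 2)"
  define K2 where "K2 = K * K1 / c1 powr p"
  have c1: "0 < c1"
    using unit_ball_vol_pos[of "real CARD('n)"] R(1) unfolding c1_def by (simp del: unit_ball_vol_pos)
  have K1: "0 \<le> K1" and K2: "0 \<le> K2"
    using K(1) by (auto simp: K1_def K2_def)
  define S :: "nat \<Rightarrow> 'n heis set \<Rightarrow> 'n heis set"
    where "S k G = rich_directions R ((1/2) ^ k) (c1 * \<theta> ^ k * ((1/2) ^ k) ^ (2 * CARD('n))) G" for k G
  have level: "emeasure sphere_measure (S k G) \<le> ennreal (K2 * x ^ k)"
    if G: "G \<in> sets borel" "emeasure lborel G \<le> ennreal (K1 * ((1/2) ^ k) powr (d - s))" and k: "1 \<le> k"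
    for k G
  proof -
    define \<delta> :: real where "\<delta> = (1/2) ^ k"
    have \<delta>: "0 < \<delta>" "\<delta> < 1"
      using k by (auto simp: \<delta>_def power_less_one_iff)
    have pw: "(c1 * \<theta> ^ k) powr p = c1 powr p * x ^ k" "\<delta> powr (- \<beta> * p) * \<delta> powr (d - s) = x ^ k * x ^ k"
    proof -
      have \<theta>x: "\<theta> powr p = x"
        using p by (simp add: \<theta>_def x_def powr_powr)
      have "(\<theta> ^ k) powr p = (\<theta> powr p) ^ k"
        using \<theta> by (simp add: powr_realpow[symmetric] powr_powr mult.commute)
      then show "(c1 * \<theta> ^ k) powr p = c1 powr p * x ^ k"
        using c1 \<theta> by (simp add: powr_mult \<theta>x)
      have "\<delta> powr (- \<beta> * p) * \<delta> powr (d - s) = \<delta> powr \<alpha>"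
        by (simp add: powr_add[symmetric] \<alpha>_def algebra_simps)
      also have "\<dots> = \<delta> powr (\<alpha> / 2) * \<delta> powr (\<alpha> / 2)"
        by (simp add: powr_add[symmetric])
      also have "\<delta> powr (\<alpha> / 2) = x ^ k"
        by (simp add: \<delta>_def x_def half_power_powr)
      finally show "\<delta> powr (- \<beta> * p) * \<delta> powr (d - s) = x ^ k * x ^ k" .
    qed
    have "ennreal (c1 powr p * x ^ k) * emeasure sphere_measure (S k G)
        \<le> ennreal (K * \<delta> powr (- \<beta> * p)) * emeasure lborel G"
      unfolding S_def \<delta>_def[symmetric] pw(1)[symmetric]
      by (rule K(2)) (use G \<delta> c1 \<theta> in \<open>auto intro: le_less_trans\<close>)
    also have "\<dots> \<le> ennreal (K * \<delta> powr (- \<beta> * p)) * ennreal (K1 * \<delta> powr (d - s))"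
      using G(2) by (intro mult_left_mono) (auto simp: \<delta>_def)
    also have "\<dots> = ennreal (K * K1 * (x ^ k * x ^ k))"
      using K(1) K1 by (subst ennreal_mult[symmetric]) (auto simp: pw(2)[symmetric])
    also have "\<dots> = ennreal (c1 powr p * x ^ k) * ennreal (K2 * x ^ k)"
    proof -
      have "K * K1 * (x ^ k * x ^ k) = (c1 powr p * x ^ k) * (K2 * x ^ k)"
        using c1 by (simp add: K2_def)
      then show ?thesis
        using K2 x by (simp only:) (intro ennreal_mult mult_nonneg_nonneg; simp)
    qed
    finally show ?thesis
      using c1 x by (subst (asm) ennreal_mult_le_mult_iff) auto
  qed
  have "(\<lambda>k. \<theta> ^ k / (1 - \<theta>)) \<longlonglongrightarrow> 0 / (1 - \<theta>)"
    using \<theta> by (intro tendsto_intros LIMSEQ_power_zero) auto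
  then have "\<forall>\<^sub>F k in sequentially. \<theta> ^ k / (1 - \<theta>) < 1/2"
    by (rule order_tendstoD(2)) simp
  moreover have "(\<lambda>k. ennreal (K2 * x ^ k / (1 - x))) \<longlonglongrightarrow> ennreal (K2 * 0 / (1 - x))"
    using x by (intro tendsto_ennrealI tendsto_intros LIMSEQ_power_zero) auto
  then have "\<forall>\<^sub>F k in sequentially.
      ennreal (K2 * x ^ k / (1 - x)) < emeasure sphere_measure (vertical_cap R :: 'n heis set)"
    by (rule order_tendstoD(2)) (simp add: emeasure_vertical_cap_pos[OF R(1)])
  ultimately have ev: "\<forall>\<^sub>F k in sequentially. 1 \<le> k \<and> \<theta> ^ k / (1 - \<theta>) < 1/2 \<and>
      ennreal (K2 * x ^ k / (1 - x)) < emeasure sphere_measure (vertical_cap R :: 'n heis set)"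
    by (intro eventually_conj eventually_ge_at_top)
  obtain k\<^sub>0 where k\<^sub>0: "1 \<le> k\<^sub>0" "\<theta> ^ k\<^sub>0 / (1 - \<theta>) < 1/2"
      "ennreal (K2 * x ^ k\<^sub>0 / (1 - x)) < emeasure sphere_measure (vertical_cap R :: 'n heis set)"
    using eventually_happens'[OF sequentially_bot ev] by (elim exE conjE)
  obtain c :: "nat \<Rightarrow> 'n heis" and k :: "nat \<Rightarrow> nat" where ck: "\<And>i. k\<^sub>0 \<le> k i"
      "B \<subseteq> (\<Union>i. heis_plate (c i) ((1/2) ^ k i))" "(\<Sum>i. ennreal (((1/2) ^ k i) powr s)) \<le> 1"
    by (rule dyadic_cover_if_hausdorff_measure_0[OF null s\<^sub>0(1) s, of k\<^sub>0]) (rule that; assumption)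
  define G where "G m = (\<Union>i\<in>{i. k i = m}. heis_plate (c i) (3 * (1/2) ^ m))" for m
  have G: "G m \<in> sets borel" "emeasure lborel (G m) \<le> ennreal (K1 * ((1/2) ^ m) powr (d - s))" for m
  proof -
    show "G m \<in> sets borel"
      unfolding G_def by (intro sets.countable_UN') auto
    show "emeasure lborel (G m) \<le> ennreal (K1 * ((1/2) ^ m) powr (d - s))"
      unfolding G_def K1_def d_def
      by (rule emeasure_Union_heis_plates_le[OF _ ck(3)]) auto
  qed
  have "vertical_cap R \<subseteq> (\<Union>j. S (k\<^sub>0 + j) (G (k\<^sub>0 + j)))"
  proof
    fix e :: "'n heis" assume e: "e \<in> vertical_cap R"
    obtain u v h where uvh: "e = (u, v, h)" by (metis prod_cases3)
    have h: "norm (u, v, h) = 1" "0 < h" "norm u < h / (8 * R)" "norm v < h / (8 * R)"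
      using e by (auto simp: vertical_cap_def uvh)
    obtain b where b: "(\<lambda>t. t *\<^sub>R e + b) ` {0..1} \<subseteq> B"
      using segs[of e] h(1) by (auto simp: uvh)
    obtain b1 b2 b3 where b123: "b = (b1, b2, b3)" by (metis prod_cases3)
    have seg: "t *\<^sub>R e + b \<in> B" if "0 \<le> t" "t \<le> 1" for t
      using b that unfolding image_subset_iff by simp
    have "b \<in> B"
      using seg[of 0] by simp
    then have nb: "norm b1 \<le> R" "norm b2 \<le> R"
      using R(2)[of b] norm_le_triple[where x = b1 and y = b2 and t = b3] by (auto simp: b123)
    define P where "P j = (\<Union>i\<in>{i. k i = k\<^sub>0 + j}. (\<lambda>t. t *\<^sub>R e + b) -` heis_plate (c i) ((1/2) ^ (k\<^sub>0 + j)))" for j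
    have P: "P j \<in> sets borel" for j
    proof -
      have "(\<lambda>t. t *\<^sub>R e + b) -` heis_plate (c i) r \<in> sets borel" for i r
        using measurable_sets[of "\<lambda>t. t *\<^sub>R e + b" borel borel "heis_plate (c i) r"] by simp
      then show ?thesis
        unfolding P_def by (intro sets.countable_UN') auto
    qed
    have "{1/4..1/4 + 1/2} \<subseteq> (\<Union>j. P j)"
    proof
      fix t :: real assume "t \<in> {1/4..1/4 + 1/2}"
      then have "t *\<^sub>R e + b \<in> B"
        by (intro seg) auto
      from subsetD[OF ck(2) this] obtain i where i: "t *\<^sub>R e + b \<in> heis_plate (c i) ((1/2) ^ k i)"
        by (rule UN_E)
      moreover obtain j where "k i = k\<^sub>0 + j"
        using ck(1)[of i] le_Suc_ex by blast
      ultimately have "t \<in> P j"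
        unfolding P_def by (intro UN_I[of i]) simp_all
      then show "t \<in> (\<Union>j. P j)"
        by (rule UN_I[OF UNIV_I])
    qed
    from exists_level_if_half_interval_covered[OF P this less_imp_le[OF \<theta>(1)] \<theta>(2) k\<^sub>0(2)]
    obtain j where j: "ennreal (\<theta> ^ (k\<^sub>0 + j)) < emeasure lborel ({1/4..1/4 + 1/2} \<inter> P j)"
      by blast
    define m where "m = k\<^sub>0 + j"
    define \<delta> :: real where "\<delta> = (1/2) ^ m"
    define J where "J = {1/4..1/4 + 1/2} \<inter> P j"
    have \<delta>: "0 < \<delta>" "\<delta> < 1"
      using k\<^sub>0(1) by (auto simp: \<delta>_def m_def power_less_one_iff)
    have "heis_mult (t *\<^sub>R (u, v, h) + (b1, b2, b3)) (y, z, 0) \<in> G m"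
      if t: "t \<in> J" and yz: "norm y \<le> \<delta>" "norm z \<le> \<delta>" for t y z
    proof -
      obtain i where i: "k i = m" "t *\<^sub>R e + b \<in> heis_plate (c i) \<delta>"
        using t by (auto simp: J_def P_def m_def[symmetric] \<delta>_def[symmetric])
      then have "heis_mult (t *\<^sub>R e + b) (y, z, 0) \<in> heis_plate (c i) (3 * \<delta>)"
        using heis_mult_horizontal_mem_plate yz by blast
      then show ?thesis
        using i(1) by (auto simp: G_def \<delta>_def uvh b123)
    qed
    then have "ennreal ((unit_ball_vol CARD('n) * (\<delta> / (80 * R)) ^ CARD('n))\<^sup>2 / 4) * emeasure lborel J
      \<le> emeasure lborel (open_tube \<delta> (u, v, h) ((1/2) *\<^sub>R (u, v, h) + (b1, b2, b3)) \<inter> G m)"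
      using h R(1) nb \<delta> G(1) P by (intro emeasure_open_tube_Int_swept_set) (auto simp: J_def)
    moreover have "(unit_ball_vol CARD('n) * (\<delta> / (80 * R)) ^ CARD('n))\<^sup>2 / 4 = c1 * \<delta> ^ (2 * CARD('n))"
      unfolding c1_def power_even_eq power_divide by (simp add: power_mult_distrib power_divide)
    ultimately have big: "ennreal (c1 * \<delta> ^ (2 * CARD('n))) * emeasure lborel J
      \<le> emeasure lborel (open_tube \<delta> e ((1/2) *\<^sub>R e + b) \<inter> G m)"
      by (simp only: uvh b123)
    have "ennreal (c1 * \<theta> ^ m * \<delta> ^ (2 * CARD('n))) = ennreal (c1 * \<delta> ^ (2 * CARD('n))) * ennreal (\<theta> ^ m)"
      using c1 \<theta> \<delta> by (subst ennreal_mult[symmetric]) (auto simp: mult_ac)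
    also have "\<dots> < ennreal (c1 * \<delta> ^ (2 * CARD('n))) * emeasure lborel J"
      using j c1 \<delta> unfolding J_def m_def by (intro ennreal_mult_strict_left_mono) auto
    also note big
    finally have "e \<in> S m (G m)"
      using e unfolding S_def rich_directions_def \<delta>_def[symmetric] mem_Collect_eq
      by (intro conjI exI)
    then show "e \<in> (\<Union>j. S (k\<^sub>0 + j) (G (k\<^sub>0 + j)))"
      unfolding m_def by (rule UN_I[OF UNIV_I])
  qed
  then have "emeasure sphere_measure (vertical_cap R :: 'n heis set) \<le> ennreal (K2 * x ^ k\<^sub>0 / (1 - x))"
  proof (rule emeasure_le_geometric_if_covered[rotated])
    show "emeasure sphere_measure (S (k\<^sub>0 + j) (G (k\<^sub>0 + j))) \<le> ennreal (K2 * x ^ (k\<^sub>0 + j))" for j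
      using k\<^sub>0(1) by (intro level G) simp
    show "S (k\<^sub>0 + j) (G (k\<^sub>0 + j)) \<in> sets sphere_measure" for j
      unfolding S_def by (intro rich_directions_measurable G)
  qed (use K2 x in auto)
  with k\<^sub>0(3) show False
    by simp
qed

lemma heis_dim_ge_if_kakeya_maximal_estimate:
  fixes B :: "'n::finite heis set"
  assumes "kakeya_maximal_estimate TYPE('n heis) p \<beta>" "0 < p" "besicovitch B" "bounded B"
  shows "ereal (2 * real CARD('n) + 2 - \<beta> * p) \<le> heis_dim B"
  unfolding heis_dim_def hausdorff_dim_def
proof (rule Inf_greatest)
  fix t assume "t \<in> {ereal s |s. 0 \<le> s \<and> hausdorff_measure heis_dist s B = 0}"
  then obtain s where s: "t = ereal s" "0 \<le> s" "hausdorff_measure heis_dist s B = 0"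
    by blast
  then have "\<not> s < 2 * real CARD('n) + 2 - \<beta> * p"
    using hausdorff_measure_ne_0_if_kakeya_maximal_estimate[of p \<beta> B s] assms
    unfolding besicovitch_def by blast
  then show "ereal (2 * real CARD('n) + 2 - \<beta> * p) \<le> t"
    using s(1) by simp
qed

lemma heis_dim_le_if_bounded:
  fixes B :: "'n::finite heis set"
  assumes "bounded B"
  shows "heis_dim B \<le> ereal (2 * real CARD('n) + 2)"
proof (rule ereal_le_epsilon2)
  fix \<epsilon> :: real assume "0 < \<epsilon>"
  then have "hausdorff_measure heis_dist (2 * real CARD('n) + 2 + \<epsilon>) B = 0"
    using assms by (intro hausdorff_measure_heis_eq_0) auto
  then show "heis_dim B \<le> ereal (2 * real CARD('n) + 2) + ereal \<epsilon>"
    unfolding heis_dim_def hausdorff_dim_def using \<open>0 < \<epsilon>\<close> by (intro Inf_lower) auto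
qed

theorem theorem1:
  shows "(\<forall>p \<beta> :: real.
            1 < p \<and> p < 2 * real CARD('n) + 1 \<and> 0 < \<beta> \<and> 2 * real CARD('n) + 2 - \<beta> * p > 0 \<and>
            kakeya_maximal_estimate TYPE('n::finite heis) p \<beta> \<longrightarrow>
            (\<forall>B :: 'n heis set. besicovitch B \<and> bounded B \<longrightarrow>
               heis_dim B \<ge> ereal (2 * real CARD('n) + 2 - \<beta> * p)))
         \<and>
         ((\<exists>p::real. 1 \<le> p \<and> (\<forall>\<beta>>0. kakeya_maximal_estimate TYPE('n heis) p \<beta>)) \<longrightarrow>
            (\<forall>B :: 'n heis set. besicovitch B \<and> bounded B \<longrightarrow>
               heis_dim B = ereal (2 * real CARD('n) + 2)))"
proof (intro conjI allI impI; elim conjE exE)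
  fix p \<beta> :: real and B :: "'n heis set"
  assume "1 < p" "kakeya_maximal_estimate TYPE('n heis) p \<beta>" "besicovitch B" "bounded B"
  then show "ereal (2 * real CARD('n) + 2 - \<beta> * p) \<le> heis_dim B"
    by (intro heis_dim_ge_if_kakeya_maximal_estimate) auto
next
  fix p :: real and B :: "'n heis set"
  assume p: "1 \<le> p" "\<forall>\<beta>>0. kakeya_maximal_estimate TYPE('n heis) p \<beta>" and B: "besicovitch B" "bounded B"
  show "heis_dim B = ereal (2 * real CARD('n) + 2)"
  proof (rule antisym[OF heis_dim_le_if_bounded[OF B(2)]], rule ereal_le_epsilon2)
    fix \<epsilon> :: real assume "0 < \<epsilon>"
    then have "ereal (2 * real CARD('n) + 2 - (\<epsilon> / p) * p) \<le> heis_dim B"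
      using p B by (intro heis_dim_ge_if_kakeya_maximal_estimate) auto
    then show "ereal (2 * real CARD('n) + 2) \<le> heis_dim B + ereal \<epsilon>"
      using p(1) by (cases "heis_dim B") auto
  qed
qed

end
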